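(* Let $K\subset\mathbb{R}^2$ be a compact convex set with boundary of class $\mathcal{C}^2$ and of length $L$, having the origin as an interior point. Let $f$ be a $2\pi$-periodic continuous function on $\mathbb{R}$ with Fourier expansion $$f(\varphi)=\sum_{n\ge 0}A_n\cos(n\varphi)+B_n\sin(n\varphi).$$ Then $$\int_{G_i\cap K\neq\emptyset}f(\varphi_2-\varphi_1)\,dG_1\,dG_2=A_0L^2+\pi^2\sum_{n\ge 1}c_n^2A_n,$$ with $c_n^2=a_n^2+b_n^2$, where $a_n,b_n$ are the Fourier coefficients of the support function $p(\varphi)$ of $K$.
   Context: A line $G\subset\mathbb{R}^2$ not passing through the origin is given coordinates $(p,\varphi)$, $p>0$, $0\le\varphi<2\pi$, which are the polar coordinates of the point of $G$ at minimum distance from the origin (lines through the origin form a null set and are disregarded). $dG=dp\,d\varphi$, and ordered pairs of lines $(G_1,G_2)$, with coordinates $(p_i,\varphi_i)$, carry the measure $dG_1\,dG_2=dp_1\,d\varphi_1\,dp_2\,d\varphi_2$. The integral over $G_i\cap K\neq\emptyset$ is over all ordered pairs $(G_1,G_2)$ such that both $G_1$ and $G_2$ meet $K$. The support function $p(\varphi)$ is the distance from the origin to the tangent line to $K$ whose (outward) normal makes angle $\varphi$ with the positive real axis, i.e. $p(\varphi)=\max_{(x,y)\in K}(x\cos\varphi+y\sin\varphi)$. Its Fourier coefficients are those in $p(\varphi)=a_0+\sum_{n\ge1}(a_n\cos(n\varphi)+b_n\sin(n\varphi))$; constant terms are means: $a_0=\frac1{2\pi}\int_0^{2\pi}p$ and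 $A_0=\frac1{2\pi}\int_0^{2\pi}f$, while for $n\ge1$ e.g. $A_n=\frac1\pi\int_0^{2\pi}f(\varphi)\cos(n\varphi)\,d\varphi$. The expansion of $f$ is understood as its Fourier series. *)

theory Defs
  imports "HOL-Analysis.Analysis"
begin

section \<open>Lines in the plane and the line measure\<close>

definition unit_dir :: "real \<Rightarrow> real ^ 2"
  where "unit_dir \<phi> = vector [cos \<phi>, sin \<phi>]"

definition polar_line :: "real \<times> real \<Rightarrow> (real ^ 2) set"
  where "polar_line G = {x. unit_dir (snd G) \<bullet> x = fst G}"

text \<open>For \<open>p > 0\<close>, the line with coordinates \<open>(p, \<phi>)\<close> is the one whose point nearest
  to the origin has polar coordinates \<open>(p, \<phi>)\<close>; conversely, every line missing the origin
  has unique such coordinates.\<close>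

lemma norm_unit_dir [simp]: "norm (unit_dir \<phi>) = 1"
  by (simp add: unit_dir_def norm_eq_1 inner_vec_def sum_2 flip: power2_eq_square)

lemma aff_dim_polar_line: "aff_dim (polar_line G) = 1"
proof -
  have "unit_dir (snd G) \<noteq> 0"
    using norm_unit_dir[of "snd G"] by force
  then show ?thesis
    by (simp add: polar_line_def)
qed

lemma closest_point_polar_line: "closest_point (polar_line (p, \<phi>)) 0 = p *\<^sub>R unit_dir \<phi>"
proof -
  have u: "unit_dir \<phi> \<bullet> unit_dir \<phi> = 1"
    by (simp flip: norm_eq_1)
  have "dist 0 (p *\<^sub>R unit_dir \<phi>) \<le> dist 0 z" if "z \<in> polar_line (p, \<phi>)" for z
    using that Cauchy_Schwarz_ineq2[of "unit_dir \<phi>" z] by (simp add: polar_line_def)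
  moreover have "p *\<^sub>R unit_dir \<phi> \<in> polar_line (p, \<phi>)"
    by (simp add: polar_line_def u)
  moreover have "convex (polar_line (p, \<phi>))" "closed (polar_line (p, \<phi>))"
    by (simp_all add: polar_line_def convex_hyperplane closed_hyperplane)
  ultimately show ?thesis
    using closest_point_unique by metis
qed

lemma ex1_polar_line:
  assumes "affine G" "aff_dim G = 1" "0 \<notin> G"
  shows "\<exists>!c. c \<in> {0<..} \<times> {0..<2 * pi} \<and> G = polar_line c"
proof -
  have "aff_dim G = int (DIM(real ^ 2)) - 1" using assms by simp
  then obtain a b where ab: "a \<noteq> 0" "G = {x. a \<bullet> x = b}"
    using aff_dim_eq_hyperplane[of G] assms(1) by (auto simp: affine_hull_eq[THEN iffD2])
  have "b \<noteq> 0" using ab assms(3) by auto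
  define s where "s = sgn b / norm a"
  have s: "s \<noteq> 0" "s * b > 0" "norm (s *\<^sub>R a) = 1"
    using ab(1) \<open>b \<noteq> 0\<close> by (auto simp: s_def sgn_if divide_less_0_iff)
  have "(s * a $ 1)\<^sup>2 + (s * a $ 2)\<^sup>2 = 1"
    using s(3) unfolding norm_eq_1 by (simp add: inner_vec_def sum_2 power2_eq_square)
  then obtain t where t: "0 \<le> t" "t < 2 * pi" "s * a $ 1 = cos t" "s * a $ 2 = sin t"
    using sincos_total_2pi by blast
  have u: "unit_dir t = s *\<^sub>R a"
    by (simp add: unit_dir_def vec_eq_iff forall_2 t)
  have G: "G = polar_line (s * b, t)"
    using s(1) by (auto simp: ab polar_line_def u)
  show ?thesis
  proof (rule ex1I[of _ "(s * b, t)"])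
    fix c assume c: "c \<in> {0<..} \<times> {0..<2 * pi} \<and> G = polar_line c"
    obtain p \<phi> where [simp]: "c = (p, \<phi>)" by (cases c)
    have eq: "p *\<^sub>R unit_dir \<phi> = (s * b) *\<^sub>R unit_dir t"
      using G c by (simp flip: closest_point_polar_line)
    have "p = norm (p *\<^sub>R unit_dir \<phi>)" using c by simp
    also have "\<dots> = s * b" unfolding eq using s(2) by simp
    finally have p: "p = s * b" .
    then have "unit_dir \<phi> = unit_dir t" using eq s(2) by auto
    then have cs: "cos \<phi> = cos t" "sin \<phi> = sin t"
      by (simp_all add: unit_dir_def vec_eq_iff forall_2)
    then obtain n :: int where n: "\<phi> = t + 2 * pi * n"
      using sin_cos_eq_iff[of \<phi> t] by auto
    have "2 * pi * \<bar>real_of_int n\<bar> < 2 * pi * 1"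
    proof -
      have "\<bar>2 * pi * real_of_int n\<bar> < 2 * pi" using n c t by auto
      then show ?thesis by (simp add: abs_mult)
    qed
    then have "\<bar>real_of_int n\<bar> < 1" by (simp only: mult_less_cancel_left_pos pi_gt_zero mult_pos_pos zero_less_numeral)
    then have "n = 0" by linarith
    then show "c = (s * b, t)" using n p by simp
  qed (use t s G in auto)
qed

definition line_measure :: "(real \<times> real) measure"
  where "line_measure = restrict_space lborel ({0<..} \<times> {0..<2 * pi})"

definition line_pairs_meeting :: "(real ^ 2) set \<Rightarrow> ((real \<times> real) \<times> (real \<times> real)) set"
  where "line_pairs_meeting K = {(G1, G2) \<in> space (line_measure \<Otimes>\<^sub>M line_measure).
           polar_line G1 \<inter> K \<noteq> {} \<and> polar_line G2 \<inter> K \<noteq> {}}"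


section \<open>Convex sets with boundary of class \<open>C\<^sup>2\<close>\<close>

definition support_fun :: "(real ^ 2) set \<Rightarrow> real \<Rightarrow> real"
  where "support_fun K \<phi> = (SUP x\<in>K. unit_dir \<phi> \<bullet> x)"

text \<open>Parametrizations have period 1, so that the restriction to \<open>[0, 1]\<close> is a closed path
  in the sense of the library, while the derivatives also match where the curve closes up.\<close>

definition regular_C2_loop :: "(real \<Rightarrow> real ^ 2) \<Rightarrow> bool"
  where "regular_C2_loop g \<longleftrightarrow>
    (\<forall>t. g (t + 1) = g t) \<and>
    g C1_differentiable_on UNIV \<and>
    (\<lambda>t. vector_derivative g (at t)) C1_differentiable_on UNIV \<and>
    (\<forall>t. vector_derivative g (at t) \<noteq> 0)"

definition curve_length :: "(real \<Rightarrow> real ^ 2) \<Rightarrow> real"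
  where "curve_length g = integral {0..1} (\<lambda>t. norm (vector_derivative g (at t)))"

definition C2_boundary_of_length :: "(real ^ 2) set \<Rightarrow> real \<Rightarrow> bool"
  where "C2_boundary_of_length K L \<longleftrightarrow>
    (\<exists>g. regular_C2_loop g \<and> simple_path g \<and> path_image g = frontier K \<and> curve_length g = L)"


section \<open>Fourier coefficients\<close>

text \<open>The constant term is the mean of the function, without the factor 2 of the other
  coefficients.\<close>

definition fourier_cos_coeff :: "(real \<Rightarrow> real) \<Rightarrow> nat \<Rightarrow> real"
  where "fourier_cos_coeff f n =
    (if n = 0 then 1 / (2 * pi) else 1 / pi) * integral {0..2 * pi} (\<lambda>\<phi>. f \<phi> * cos (real n * \<phi>))"

definition fourier_sin_coeff :: "(real \<Rightarrow> real) \<Rightarrow> nat \<Rightarrow> real"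
  where "fourier_sin_coeff f n = 1 / pi * integral {0..2 * pi} (\<lambda>\<phi>. f \<phi> * sin (real n * \<phi>))"

end

theory Submission
  imports Defs "HOL-Library.Periodic_Fun"
begin

text \<open>
  Write \<open>h\<close> for the support function of \<open>K\<close>.  A line with coordinates \<open>(p, \<phi>)\<close> meets \<open>K\<close> exactly if
  \<open>p \<le> h \<phi>\<close> (\<open>polar_line_meets_iff\<close>).  Integrating out the two distances turns the integral over
  pairs of lines into the double integral of \<open>f (y - x) * h x * h y\<close> over the square of
  side \<open>2 * pi\<close>, the correlation integral of \<open>h\<close> against \<open>f\<close> (\<open>line_pairs_integral\<close>).
  Two facts about it give the theorem.

  The first is a Parseval formula, \<open>correlation_integral_fourier\<close>.  The Fourier series of \<open>f\<close>
  need not converge, so it cannot be inserted under the integral.  Instead, both sides of the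
  formula are regarded as linear functionals of \<open>f\<close>.  They are bounded in the supremum norm, on
  the side of the series because the squares \<open>c\<^sub>n\<^sup>2\<close> are summable by Bessel's inequality.  They
  agree on \<open>cos (m * t)\<close> by the orthogonality relations, hence on all even continuous functions by
  the Weierstrass approximation theorem.  Both are invariant under \<open>t \<mapsto> - t\<close>, so that the odd part
  of \<open>f\<close> does not contribute.  The constant term of the formula is the mean of \<open>f\<close> times the
  square of the integral of \<open>h\<close>.

  The second is Cauchy's formula \<open>cauchy_length_formula\<close>: the integral of \<open>h\<close> is the length of the
  boundary curve.  The norm of a vector is a quarter of the integral of its projections over all
  directions, so four times the length is the integral over all \<open>\<phi>\<close> of the total variation of the
  projection of the curve to the direction \<open>\<phi>\<close>.  By convexity a line through an interior
  point meets the boundary at most twice.  The projection therefore passes once from its minimum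
  to its maximum and once back, and its total variation is \<open>2 * (h \<phi> + h (\<phi> + pi))\<close>.
\<close>

section \<open>Integrals of periodic and trigonometric functions\<close>

text \<open>Splitting \<open>{0..s + T}\<close> at \<open>s\<close> and at \<open>T\<close> leaves the pieces \<open>{0..s}\<close> and
  \<open>{T..s + T}\<close>, which are translates of each other.  For negative \<open>s\<close> the same is done
  with \<open>{s..T}\<close>.\<close>

lemma integral_over_period:
  fixes f :: "real \<Rightarrow> real"
  assumes cont: "continuous_on UNIV f" and period: "\<And>x. f (x + T) = f x" and "0 \<le> T"
  shows "integral {s..s + T} f = integral {0..T} f"
proof -
  have int: "f integrable_on {a..b}" for a b
    using cont continuous_on_subset integrable_continuous_real by blast
  note combine = Henstock_Kurzweil_Integration.integral_combine[OF _ _ int]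
  have shift: "integral {a..b} f = integral {a + T..b + T} f" for a b
    using integral_shift_Icc_real[of a b f T] by (simp add: comp_def add.commute period)
  show ?thesis
  proof (cases "0 \<le> s")
    case True
    then show ?thesis
      using combine[of 0 s "s + T"] combine[of 0 T "s + T"] shift[of 0 s] \<open>0 \<le> T\<close> by simp
  next
    case False
    then show ?thesis
      using combine[of s 0 T] combine[of s "s + T" T] shift[of s 0] \<open>0 \<le> T\<close> by simp
  qed
qed

lemma integral_period_reflect:
  fixes f :: "real \<Rightarrow> real"
  assumes "continuous_on UNIV f" "\<And>x. f (x + T) = f x" "0 \<le> T"
  shows "integral {0..T} (\<lambda>x. f (- x)) = integral {0..T} f"
  using integral_over_period[of f T "- T"] assms
    Henstock_Kurzweil_Integration.integral_reflect_real[where a="-T" and b=0 and f=f]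
  by simp

lemma has_integral_cos_int:
  "((\<lambda>t. cos (of_int k * t)) has_integral (if k = 0 then 2 * pi else 0)) {0..2 * pi}"
proof (cases "k = 0")
  case True
  have "((\<lambda>t. 1::real) has_integral 1 * (2 * pi - 0)) {0..2 * pi}"
    using has_integral_const_real[of "1::real" 0 "2 * pi"] by simp
  then show ?thesis using True by simp
next
  case False
  have "((\<lambda>t. cos (of_int k * t)) has_integral
      (sin (of_int k * (2 * pi)) / of_int k - sin (of_int k * 0) / of_int k)) {0..2 * pi}"
    by (rule fundamental_theorem_of_calculus)
       (use False in \<open>auto intro!: derivative_eq_intros
          simp flip: has_real_derivative_iff_has_vector_derivative\<close>)
  moreover have "sin (of_int k * (2 * pi)) = 0"
    using sin.plus_of_int[of "0::real" k] by simp
  ultimately show ?thesis using False by simp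
qed

lemma has_integral_cos_cos:
  "((\<lambda>t. cos (real m * t) * cos (real n * t)) has_integral
      (if m = n then if n = 0 then 2 * pi else pi else 0)) {0..2 * pi}"
proof -
  have "((\<lambda>t. (cos (of_int (int m - int n) * t) + cos (of_int (int m + int n) * t)) / 2) has_integral
     ((if int m - int n = 0 then 2 * pi else 0) + (if int m + int n = 0 then 2 * pi else 0)) / 2)
     {0..2 * pi}"
    by (intro has_integral_divide has_integral_add has_integral_cos_int)
  then show ?thesis
    using has_integral_const_real[of "1::real" 0 "2 * pi"]
    by (cases "m = n"; cases "n = 0") (auto simp: cos_times_cos algebra_simps of_nat_diff)
qed

lemma has_integral_sin_sin:
  "((\<lambda>t. sin (real m * t) * sin (real n * t)) has_integral
      (if m = n \<and> n \<noteq> 0 then pi else 0)) {0..2 * pi}"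
proof -
  have "((\<lambda>t. (cos (of_int (int m - int n) * t) - cos (of_int (int m + int n) * t)) / 2) has_integral
     ((if int m - int n = 0 then 2 * pi else 0) - (if int m + int n = 0 then 2 * pi else 0)) / 2)
     {0..2 * pi}"
    by (intro has_integral_divide has_integral_diff has_integral_cos_int)
  then show ?thesis
    by (auto simp: sin_times_sin algebra_simps split: if_splits)
qed

section \<open>Bessel's inequality\<close>

text \<open>The projection of \<open>h\<close> on the span of the orthogonal family is \<open>\<Sum>i\<in>S. c i * e i\<close>, and
  the inequality says that the square of the remainder has a nonnegative integral.  The common
  squared norm \<open>r\<close> is left general because the trigonometric functions are used without normalization.\<close>

lemma bessel_inequality:
  fixes h :: "real \<Rightarrow> real" and e :: "'i \<Rightarrow> real \<Rightarrow> real"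
  assumes h: "continuous_on {a..b} h" and e: "\<And>i. i \<in> S \<Longrightarrow> continuous_on {a..b} (e i)"
    and "finite S" and "r > 0"
    and orth: "\<And>i j. i \<in> S \<Longrightarrow> j \<in> S \<Longrightarrow>
      ((\<lambda>t. e i t * e j t) has_integral (if i = j then r else 0)) {a..b}"
  shows "(\<Sum>i\<in>S. (integral {a..b} (\<lambda>t. h t * e i t))\<^sup>2) \<le> r * integral {a..b} (\<lambda>t. (h t)\<^sup>2)"
proof -
  define c where "c i = integral {a..b} (\<lambda>t. h t * e i t) / r" for i
  have c: "((\<lambda>t. h t * e i t) has_integral r * c i) {a..b}" if "i \<in> S" for i
  proof -
    have "(\<lambda>t. h t * e i t) integrable_on {a..b}"
      by (intro integrable_continuous_real continuous_intros h e that)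
    then show ?thesis using \<open>r > 0\<close> by (simp add: c_def has_integral_integral)
  qed
  have hh: "((\<lambda>t. (h t)\<^sup>2) has_integral integral {a..b} (\<lambda>t. (h t)\<^sup>2)) {a..b}"
    by (intro integrable_integral integrable_continuous_real continuous_intros h)
  have "((\<lambda>t. (h t)\<^sup>2 - 2 * (\<Sum>i\<in>S. c i * (h t * e i t))
            + (\<Sum>i\<in>S. \<Sum>j\<in>S. c i * c j * (e i t * e j t))) has_integral
        integral {a..b} (\<lambda>t. (h t)\<^sup>2) - 2 * (\<Sum>i\<in>S. c i * (r * c i))
            + (\<Sum>i\<in>S. \<Sum>j\<in>S. c i * c j * (if i = j then r else 0))) {a..b}"
    by (intro has_integral_add has_integral_diff has_integral_mult_right has_integral_sum
        \<open>finite S\<close> hh c orth)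
  moreover have "(\<Sum>i\<in>S. \<Sum>j\<in>S. c i * c j * (if i = j then r else 0)) = (\<Sum>i\<in>S. c i * (r * c i))"
    using \<open>finite S\<close> by (simp add: if_distrib sum.delta cong: if_cong) (simp add: mult_ac)
  moreover have "(h t)\<^sup>2 - 2 * (\<Sum>i\<in>S. c i * (h t * e i t))
            + (\<Sum>i\<in>S. \<Sum>j\<in>S. c i * c j * (e i t * e j t)) = (h t - (\<Sum>i\<in>S. c i * e i t))\<^sup>2" for t
    by (simp add: power2_diff power2_eq_square[of "sum _ _"] sum_product sum_distrib_left mult_ac)
  ultimately have "((\<lambda>t. (h t - (\<Sum>i\<in>S. c i * e i t))\<^sup>2) has_integral
      integral {a..b} (\<lambda>t. (h t)\<^sup>2) - (\<Sum>i\<in>S. c i * (r * c i))) {a..b}"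
    by simp
  then have "0 \<le> integral {a..b} (\<lambda>t. (h t)\<^sup>2) - (\<Sum>i\<in>S. c i * (r * c i))"
    by (rule has_integral_nonneg) simp
  then have "r * (\<Sum>i\<in>S. c i * (r * c i)) \<le> r * integral {a..b} (\<lambda>t. (h t)\<^sup>2)"
    using \<open>r > 0\<close> by simp
  moreover have "r * (\<Sum>i\<in>S. c i * (r * c i)) = (\<Sum>i\<in>S. (integral {a..b} (\<lambda>t. h t * e i t))\<^sup>2)"
    using \<open>r > 0\<close> by (simp add: c_def sum_distrib_left power2_eq_square)
  ultimately show ?thesis by simp
qed

text \<open>Bessel's inequality, applied to the cosines and to the sines separately, bounds the partial
  sums.  The summability is what makes the series of the main theorem depend continuously on
  \<open>f\<close> in the supremum norm, even though the Fourier series of \<open>f\<close> itself may diverge.\<close>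

lemma summable_fourier_squares:
  assumes h: "continuous_on {0..2 * pi} h"
  shows "summable (\<lambda>n. (fourier_cos_coeff h (Suc n))\<^sup>2 + (fourier_sin_coeff h (Suc n))\<^sup>2)"
proof -
  have *: "summable (\<lambda>n. (1 / pi * integral {0..2 * pi} (\<lambda>t. h t * e (Suc n) t))\<^sup>2)"
    if e: "\<And>n. continuous_on {0..2 * pi} (e n)"
      and orth: "\<And>m n. ((\<lambda>t. e (Suc m) t * e (Suc n) t) has_integral (if m = n then pi else 0)) {0..2 * pi}"
    for e :: "nat \<Rightarrow> real \<Rightarrow> real"
  proof (rule bounded_imp_summable)
    fix n
    have "(\<Sum>k\<le>n. (integral {0..2 * pi} (\<lambda>t. h t * e (Suc k) t))\<^sup>2) \<le> pi * integral {0..2 * pi} (\<lambda>t. (h t)\<^sup>2)"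
      by (rule bessel_inequality[OF h, where e = "\<lambda>n. e (Suc n)"]) (use e orth in auto)
    then show "(\<Sum>k\<le>n. (1 / pi * integral {0..2 * pi} (\<lambda>t. h t * e (Suc k) t))\<^sup>2)
        \<le> (pi * integral {0..2 * pi} (\<lambda>t. (h t)\<^sup>2)) / pi\<^sup>2"
      by (simp add: power_divide flip: sum_divide_distrib) (simp add: divide_right_mono)
  qed simp
  have "summable (\<lambda>n. (1 / pi * integral {0..2 * pi} (\<lambda>t. h t * cos (real (Suc n) * t)))\<^sup>2)"
  proof (rule *)
    show "((\<lambda>t. cos (real (Suc m) * t) * cos (real (Suc n) * t)) has_integral
        (if m = n then pi else 0)) {0..2 * pi}" for m n
      using has_integral_cos_cos[of "Suc m" "Suc n"] by (cases "m = n") simp_all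
  qed (intro continuous_intros)
  moreover have "summable (\<lambda>n. (1 / pi * integral {0..2 * pi} (\<lambda>t. h t * sin (real (Suc n) * t)))\<^sup>2)"
    by (rule *, intro continuous_intros)
      (use has_integral_sin_sin[of "Suc m" "Suc n" for m n] in simp)
  ultimately show ?thesis
    by (simp add: fourier_cos_coeff_def fourier_sin_coeff_def summable_add)
qed

section \<open>Density of the cosine polynomials\<close>

text \<open>Two angles with the same cosine differ by a multiple of the period, possibly after a reflection.\<close>

lemma even_periodic_eq_fun_of_cos:
  fixes f :: "real \<Rightarrow> 'a"
  assumes period: "\<And>x. f (x + 2 * pi) = f x" and even: "\<And>x. f (- x) = f x"
  shows "f t = f (arccos (cos t))"
proof -
  interpret periodic_fun_simple f "2 * pi" by standard (rule period)
  have "cos t = cos (arccos (cos t))" by simp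
  then obtain n where "n \<in> \<int>" "t = arccos (cos t) + 2 * n * pi \<or> t = - arccos (cos t) + 2 * n * pi"
    using cos_eq by blast
  then show ?thesis
    by (metis Ints_cases even mult.assoc mult.commute plus_of_int)
qed

text \<open>This is the density of the cosine polynomials, in the form in which it is applied: a linear
  functional that is bounded in the supremum norm and kills every \<open>cos (m * t)\<close> kills every even
  periodic function.  Such a function is a continuous function of \<open>cos t\<close>, so that the
  Weierstrass theorem on \<open>{-1..1}\<close> approximates it by polynomials in \<open>cos t\<close>; the functional
  vanishes on those because a power of \<open>cos t\<close> times \<open>cos (m * t)\<close> reduces, one factor at a
  time, to a combination of cosines of multiples.\<close>

lemma functional_zero_on_even_periodic:
  fixes D :: "(real \<Rightarrow> real) \<Rightarrow> real"
  assumes add: "\<And>f g. continuous_on UNIV f \<Longrightarrow> continuous_on UNIV g \<Longrightarrow> D (\<lambda>t. f t + g t) = D f + D g"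
    and scale: "\<And>f c. continuous_on UNIV f \<Longrightarrow> D (\<lambda>t. c * f t) = c * D f"
    and bound: "\<And>f B. continuous_on UNIV f \<Longrightarrow> (\<And>t. \<bar>f t\<bar> \<le> B) \<Longrightarrow> \<bar>D f\<bar> \<le> C * B"
    and cos: "\<And>m. D (\<lambda>t. cos (real m * t)) = 0"
    and f: "continuous_on UNIV f" "\<And>x. f (x + 2 * pi) = f x" "\<And>x. f (- x) = f x"
  shows "D f = 0"
proof -
  have power: "D (\<lambda>t. cos t ^ k * cos (real m * t)) = 0" for k m
  proof (induction k arbitrary: m)
    case 0
    then show ?case by (simp add: cos)
  next
    case (Suc k)
    \<comment> \<open>The index of \<open>cos ((m - 1) * t)\<close>, which for \<open>m = 0\<close> is \<open>cos t\<close>.\<close>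
    define m' where "m' = (if m = 0 then 1 else m - 1)"
    have m': "cos (real m' * t) = cos (t - real m * t)" for t
      using cos_minus[of "t - real m * t"] by (cases m) (simp_all add: m'_def algebra_simps)
    have "(\<lambda>t. cos t ^ Suc k * cos (real m * t))
        = (\<lambda>t. 1/2 * (cos t ^ k * cos (real (Suc m) * t)) + 1/2 * (cos t ^ k * cos (real m' * t)))"
    proof
      fix t
      have "cos t * cos (real m * t) = 1/2 * cos (real (Suc m) * t) + 1/2 * cos (real m' * t)"
        unfolding m' using cos_times_cos[of t "real m * t"] by (simp add: algebra_simps)
      then show "cos t ^ Suc k * cos (real m * t)
        = 1/2 * (cos t ^ k * cos (real (Suc m) * t)) + 1/2 * (cos t ^ k * cos (real m' * t))"
        by (metis (no_types, opaque_lifting) distrib_left mult.assoc mult.left_commute power_Suc2)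
    qed
    then show ?case
      by (simp only:) (subst add, auto intro!: continuous_intros simp only: scale Suc.IH
          continuous_intros mult_zero_right add_0)
  qed
  have poly: "D (\<lambda>t. \<Sum>i\<le>n. a i * cos t ^ i) = 0" for a :: "nat \<Rightarrow> real" and n
  proof (induction n)
    case 0
    then show ?case using scale[of "\<lambda>t. cos (real 0 * t)" "a 0"] cos[of 0]
      by (simp add: continuous_intros)
  next
    case (Suc n)
    have "D (\<lambda>t. a (Suc n) * cos t ^ Suc n) = 0"
      using scale[of "\<lambda>t. cos t ^ Suc n" "a (Suc n)"] power[of "Suc n" 0]
      by (simp add: continuous_intros del: power_Suc)
    then show ?case
      using Suc add[of "\<lambda>t. \<Sum>i\<le>n. a i * cos t ^ i" "\<lambda>t. a (Suc n) * cos t ^ Suc n"]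
      by (simp add: continuous_intros del: power_Suc)
  qed
  have "\<bar>D f\<bar> \<le> C * e" if "e > 0" for e
  proof -
    have "continuous_on {-1..1} (\<lambda>x. f (arccos x))"
      by (intro continuous_on_compose2[OF f(1)] continuous_intros) auto
    then obtain q where "real_polynomial_function q"
      and q: "\<And>x. x \<in> {-1..1} \<Longrightarrow> \<bar>f (arccos x) - q x\<bar> < e"
      using Stone_Weierstrass_real_polynomial_function[of "{-1..1}" "\<lambda>x. f (arccos x)" e] \<open>e > 0\<close>
      by auto
    then obtain a n where q_sum: "q = (\<lambda>x. \<Sum>i\<le>n. a i * x ^ i)"
      using real_polynomial_function_iff_sum by blast
    have q_cont: "continuous_on UNIV (\<lambda>t. q (cos t))"
      by (simp add: q_sum continuous_intros)
    have "D (\<lambda>t. q (cos t)) = 0" using poly by (simp add: q_sum)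
    then have "D f = D (\<lambda>t. f t + (-1) * q (cos t))"
      using add[of f "\<lambda>t. (-1) * q (cos t)"] scale[OF q_cont, of "-1"] f(1) q_cont
      by (simp add: continuous_intros)
    also have "\<bar>\<dots>\<bar> \<le> C * e"
    proof (rule bound)
      show "continuous_on UNIV (\<lambda>t. f t + (-1) * q (cos t))"
        by (intro continuous_intros f q_cont)
      show "\<bar>f t + (-1) * q (cos t)\<bar> \<le> e" for t
        using q[of "cos t"] even_periodic_eq_fun_of_cos[of f t, OF f(2,3)] by auto
    qed
    finally show ?thesis .
  qed
  then have lim: "eventually (\<lambda>e. \<bar>D f\<bar> \<le> C * e) (at_right 0)"
    by (simp add: eventually_at_right_less eventually_mono[OF eventually_at_right_less])
  have "((\<lambda>e. C * e) \<longlongrightarrow> C * 0) (at_right 0)"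
    by (intro tendsto_intros)
  then have "\<bar>D f\<bar> \<le> C * 0"
    by (rule tendsto_lowerbound[OF _ lim]) simp
  then show ?thesis by simp
qed

section \<open>Fourier coefficients and correlation integrals\<close>

text \<open>This is what the integral over pairs of lines becomes once the distances have been integrated
  out, with the support function for \<open>h\<close>.  Taking it over the square, and not as an iterated
  integral, makes linearity and the exchange of the two angles immediate.\<close>

definition correlation_integral :: "(real \<Rightarrow> real) \<Rightarrow> (real \<Rightarrow> real) \<Rightarrow> real"
  where "correlation_integral h f =
    integral (cbox (0, 0) (2 * pi, 2 * pi)) (\<lambda>(x, y). f (y - x) * h x * h y)"

lemma correlation_continuous:
  fixes h f :: "real \<Rightarrow> real"
  assumes h: "continuous_on {0..2 * pi} h" and f: "continuous_on UNIV f"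
  shows "continuous_on (cbox (0, 0) (2 * pi, 2 * pi)) (\<lambda>(x, y). f (y - x) * h x * h y)"
  unfolding case_prod_unfold
  by (intro continuous_intros continuous_on_compose2[OF f] continuous_on_compose2[OF h])
     (auto simp flip: cbox_Pair_eq)

lemma correlation_integral_iterated:
  assumes h: "continuous_on {0..2 * pi} h" and f: "continuous_on UNIV f"
  shows "correlation_integral h f =
    integral {0..2 * pi} (\<lambda>x. h x * integral {0..2 * pi} (\<lambda>y. f (y - x) * h y))"
proof -
  have "correlation_integral h f =
    integral {0..2 * pi} (\<lambda>x. integral {0..2 * pi} (\<lambda>y. f (y - x) * h x * h y))"
    unfolding correlation_integral_def
    using integral_prod_continuous[OF correlation_continuous[OF h f]] by simp
  also have "\<dots> = integral {0..2 * pi} (\<lambda>x. integral {0..2 * pi} (\<lambda>y. h x * (f (y - x) * h y)))"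
    by (simp only: mult_ac)
  finally show ?thesis by simp
qed

lemma correlation_integral_add:
  assumes h: "continuous_on {0..2 * pi} h" and "continuous_on UNIV f" "continuous_on UNIV g"
  shows "correlation_integral h (\<lambda>t. f t + g t) = correlation_integral h f + correlation_integral h g"
proof -
  let ?Q = "cbox (0, 0) (2 * pi, 2 * pi)"
  have "integral ?Q (\<lambda>z. (case z of (x, y) \<Rightarrow> f (y - x) * h x * h y) + (case z of (x, y) \<Rightarrow> g (y - x) * h x * h y))
      = correlation_integral h f + correlation_integral h g"
    unfolding correlation_integral_def
    by (intro Henstock_Kurzweil_Integration.integral_add integrable_continuous correlation_continuous assms)
  then show ?thesis
    by (simp add: correlation_integral_def case_prod_unfold distrib_right)
qed

lemma correlation_integral_scale:
  "correlation_integral h (\<lambda>t. c * f t) = c * correlation_integral h f"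
  by (simp add: correlation_integral_def case_prod_unfold mult.assoc)

text \<open>Continuity in the supremum norm of \<open>f\<close>.  The value of the constant is irrelevant;
  writing it as a correlation integral avoids evaluating it.\<close>

lemma correlation_integral_bound:
  assumes h: "continuous_on {0..2 * pi} h" and f: "continuous_on UNIV f" "\<And>t. \<bar>f t\<bar> \<le> B"
  shows "\<bar>correlation_integral h f\<bar> \<le> correlation_integral (\<lambda>t. \<bar>h t\<bar>) (\<lambda>t. 1) * B"
proof -
  have h': "continuous_on {0..2 * pi} (\<lambda>t. \<bar>h t\<bar>)" by (intro continuous_intros h)
  have "norm (correlation_integral h f) \<le> correlation_integral (\<lambda>t. \<bar>h t\<bar>) (\<lambda>t. B * 1)"
    unfolding correlation_integral_def
  proof (rule integral_norm_bound_integral)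
    show "(\<lambda>(x, y). f (y - x) * h x * h y) integrable_on cbox (0, 0) (2 * pi, 2 * pi)"
      using integrable_continuous[OF correlation_continuous[OF h f(1)]] .
    show "(\<lambda>(x, y). B * 1 * \<bar>h x\<bar> * \<bar>h y\<bar>) integrable_on cbox (0, 0) (2 * pi, 2 * pi)"
      using integrable_continuous[OF correlation_continuous[OF h', of "\<lambda>t. B * 1"]] by simp
    show "norm (case z of (x, y) \<Rightarrow> f (y - x) * h x * h y)
        \<le> (case z of (x, y) \<Rightarrow> B * 1 * \<bar>h x\<bar> * \<bar>h y\<bar>)" for z
      using f(2) by (auto simp: abs_mult case_prod_unfold mult.assoc intro!: mult_right_mono)
  qed
  also have "\<dots> = correlation_integral (\<lambda>t. \<bar>h t\<bar>) (\<lambda>t. 1) * B"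
    by (subst correlation_integral_scale) (rule mult.commute)
  finally show ?thesis by simp
qed

text \<open>By the addition theorem for \<open>cos (m * (y - x))\<close> the integrand is a sum of two functions of the
  form \<open>g x * g y\<close>.\<close>

lemma correlation_integral_cos:
  assumes h: "continuous_on {0..2 * pi} h"
  shows "correlation_integral h (\<lambda>t. cos (real m * t))
    = (integral {0..2 * pi} (\<lambda>t. h t * cos (real m * t)))\<^sup>2
      + (integral {0..2 * pi} (\<lambda>t. h t * sin (real m * t)))\<^sup>2"
proof -
  define c where "c t = h t * cos (real m * t)" for t
  define s where "s t = h t * sin (real m * t)" for t
  have cont: "continuous_on {0..2 * pi} c" "continuous_on {0..2 * pi} s"
    unfolding c_def s_def by (intro continuous_intros h)+
  have int: "(\<lambda>(x, y). g x * g y) integrable_on cbox (0, 0) (2 * pi, 2 * pi)"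
    and prod: "integral (cbox (0, 0) (2 * pi, 2 * pi)) (\<lambda>(x, y). g x * g y) = (integral {0..2 * pi} g)\<^sup>2"
    if "continuous_on {0..2 * pi} g" for g :: "real \<Rightarrow> real"
  proof -
    note k = correlation_continuous[OF that, of "\<lambda>t. 1"]
    show "(\<lambda>(x, y). g x * g y) integrable_on cbox (0, 0) (2 * pi, 2 * pi)"
      using integrable_continuous[OF k] by simp
    show "integral (cbox (0, 0) (2 * pi, 2 * pi)) (\<lambda>(x, y). g x * g y) = (integral {0..2 * pi} g)\<^sup>2"
      using correlation_integral_iterated[OF that, of "\<lambda>t. 1"]
      by (simp add: correlation_integral_def power2_eq_square)
  qed
  have "correlation_integral h (\<lambda>t. cos (real m * t))
      = integral (cbox (0, 0) (2 * pi, 2 * pi))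
          (\<lambda>z. (case z of (x, y) \<Rightarrow> c x * c y) + (case z of (x, y) \<Rightarrow> s x * s y))"
    unfolding correlation_integral_def
    by (rule arg_cong[where f = "integral _"])
       (auto simp: c_def s_def cos_diff fun_eq_iff algebra_simps)
  also have "\<dots> = (integral {0..2 * pi} c)\<^sup>2 + (integral {0..2 * pi} s)\<^sup>2"
    by (subst Henstock_Kurzweil_Integration.integral_add) (use int cont prod in auto)
  finally show ?thesis unfolding c_def s_def .
qed

lemma correlation_integral_reflect:
  assumes h: "continuous_on {0..2 * pi} h" and f: "continuous_on UNIV f"
  shows "correlation_integral h (\<lambda>t. f (- t)) = correlation_integral h f"
proof -
  have "correlation_integral h f
      = integral (cbox (0, 0) (2 * pi, 2 * pi)) (\<lambda>(x, y). f (x - y) * h y * h x)"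
    unfolding correlation_integral_def
    by (rule integral_swap_2dim) (rule correlation_continuous[OF h f])
  also have "\<dots> = correlation_integral h (\<lambda>t. f (- t))"
    by (simp add: correlation_integral_def mult.assoc mult.commute[of "h _" "h _"])
  finally show ?thesis ..
qed

lemma fourier_cos_coeff_add:
  assumes "continuous_on UNIV f" "continuous_on UNIV g"
  shows "fourier_cos_coeff (\<lambda>t. f t + g t) n = fourier_cos_coeff f n + fourier_cos_coeff g n"
proof -
  have "(\<lambda>t. k t * cos (real n * t)) integrable_on {0..2 * pi}" if "continuous_on UNIV k" for k
    using that by (intro integrable_continuous_real continuous_intros) (auto intro: continuous_on_subset)
  then show ?thesis
    using assms by (simp add: fourier_cos_coeff_def distrib_right distrib_left
        Henstock_Kurzweil_Integration.integral_add)
qed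

lemma fourier_cos_coeff_scale:
  "fourier_cos_coeff (\<lambda>t. c * f t) n = c * fourier_cos_coeff f n"
  by (simp add: fourier_cos_coeff_def mult.assoc)

lemma fourier_cos_coeff_bound:
  assumes "continuous_on UNIV f" "\<And>t. t \<in> {0..2 * pi} \<Longrightarrow> \<bar>f t\<bar> \<le> B"
  shows "\<bar>fourier_cos_coeff f n\<bar> \<le> 2 * B"
proof -
  have "norm (integral {0..2 * pi} (\<lambda>t. f t * cos (real n * t))) \<le> B * (2 * pi - 0)"
  proof (rule integral_bound)
    show "continuous_on {0..2 * pi} (\<lambda>t. f t * cos (real n * t))"
      using assms(1) by (intro continuous_intros) (auto intro: continuous_on_subset)
    fix t assume "t \<in> {0..2 * pi}"
    then have "\<bar>f t\<bar> * \<bar>cos (real n * t)\<bar> \<le> B * 1"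
      using assms(2)[of t] by (intro mult_mono) auto
    then show "norm (f t * cos (real n * t)) \<le> B" by (simp add: abs_mult)
  qed simp
  moreover have "0 \<le> B" using assms(2)[of 0] by simp
  ultimately show ?thesis
    by (auto simp: fourier_cos_coeff_def abs_mult field_simps)
qed

lemma fourier_cos_coeff_cos:
  "fourier_cos_coeff (\<lambda>t. cos (real m * t)) n = (if n = m then 1 else 0)"
  using integral_unique[OF has_integral_cos_cos[of m n]] by (simp add: fourier_cos_coeff_def)

lemma fourier_cos_coeff_reflect:
  assumes "continuous_on UNIV f" "\<And>x. f (x + 2 * pi) = f x"
  shows "fourier_cos_coeff (\<lambda>t. f (- t)) n = fourier_cos_coeff f n"
proof -
  have "cos (real n * (x + 2 * pi)) = cos (real n * x)" for x
    using cos.plus_of_nat[of "real n * x" n] by (simp add: algebra_simps)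
  then have "integral {0..2 * pi} (\<lambda>t. f (- t) * cos (real n * (- t)))
      = integral {0..2 * pi} (\<lambda>t. f t * cos (real n * t))"
    using assms by (intro integral_period_reflect continuous_intros) simp_all
  then show ?thesis by (simp add: fourier_cos_coeff_def)
qed

text \<open>Both sides of the equation are linear in \<open>f\<close>, bounded in the supremum norm of \<open>f\<close> and unchanged
  when \<open>f t\<close> is replaced by \<open>f (- t)\<close>; they agree on \<open>cos (m * t)\<close>.  Hence their difference
  \<open>D\<close> vanishes on even functions by density, and \<open>2 * D f\<close> is the value of \<open>D\<close> at the even
  function \<open>f t + f (- t)\<close>.\<close>

lemma correlation_integral_fourier:
  fixes h f :: "real \<Rightarrow> real"
  defines "c2 \<equiv> \<lambda>n. (fourier_cos_coeff h (Suc n))\<^sup>2 + (fourier_sin_coeff h (Suc n))\<^sup>2"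
  assumes h: "continuous_on {0..2 * pi} h"
    and f: "continuous_on UNIV f" and period: "\<And>x. f (x + 2 * pi) = f x"
  shows "summable (\<lambda>n. c2 n * fourier_cos_coeff f (Suc n)) \<and>
    correlation_integral h f = fourier_cos_coeff f 0 * (integral {0..2 * pi} h)\<^sup>2
          + pi\<^sup>2 * (\<Sum>n. c2 n * fourier_cos_coeff f (Suc n))"
proof -
  have c2: "summable c2" "\<And>n. 0 \<le> c2 n"
    unfolding c2_def using summable_fourier_squares[OF h] by auto
  have term_bound: "\<bar>c2 n * fourier_cos_coeff g (Suc n)\<bar> \<le> c2 n * (2 * B)"
    if "continuous_on UNIV g" "\<And>t. t \<in> {0..2 * pi} \<Longrightarrow> \<bar>g t\<bar> \<le> B" for g B n
    using fourier_cos_coeff_bound[OF that, of "Suc n"] c2(2)[of n] by (simp add: abs_mult mult_left_mono)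
  \<comment> \<open>The bound is required on one period only, where every continuous function has one.\<close>
  have series: "summable (\<lambda>n. c2 n * fourier_cos_coeff g (Suc n))"
      "\<bar>\<Sum>n. c2 n * fourier_cos_coeff g (Suc n)\<bar> \<le> suminf c2 * (2 * B)"
    if "continuous_on UNIV g" "\<And>t. t \<in> {0..2 * pi} \<Longrightarrow> \<bar>g t\<bar> \<le> B" for g B
  proof -
    have major: "summable (\<lambda>n. c2 n * (2 * B))" by (rule summable_mult2[OF c2(1)])
    have abs: "summable (\<lambda>n. \<bar>c2 n * fourier_cos_coeff g (Suc n)\<bar>)"
      by (rule summable_comparison_test'[OF major]) (use term_bound[OF that] in auto)
    then show "summable (\<lambda>n. c2 n * fourier_cos_coeff g (Suc n))"
      by (rule summable_rabs_cancel)
    have "\<bar>\<Sum>n. c2 n * fourier_cos_coeff g (Suc n)\<bar> \<le> (\<Sum>n. \<bar>c2 n * fourier_cos_coeff g (Suc n)\<bar>)"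
      by (rule summable_rabs[OF abs])
    also have "\<dots> \<le> (\<Sum>n. c2 n * (2 * B))"
      by (rule suminf_le[OF term_bound[OF that] abs major])
    also have "\<dots> = suminf c2 * (2 * B)"
      by (rule suminf_mult2[OF c2(1), symmetric])
    finally show "\<bar>\<Sum>n. c2 n * fourier_cos_coeff g (Suc n)\<bar> \<le> suminf c2 * (2 * B)" .
  qed
  have summable: "summable (\<lambda>n. c2 n * fourier_cos_coeff g (Suc n))"
    if g: "continuous_on UNIV g" for g
  proof -
    have "compact (g ` {0..2 * pi})"
      using g by (intro compact_continuous_image) (auto intro: continuous_on_subset)
    then have "bounded (g ` {0..2 * pi})" by (rule compact_imp_bounded)
    then obtain B where B: "\<forall>y \<in> g ` {0..2 * pi}. norm y \<le> B"
      unfolding bounded_iff ..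
    have "\<bar>g t\<bar> \<le> B" if "t \<in> {0..2 * pi}" for t
      using bspec[OF B imageI[OF that]] by simp
    then show ?thesis by (rule series(1)[OF g])
  qed
  define R where "R g = fourier_cos_coeff g 0 * (integral {0..2 * pi} h)\<^sup>2
      + pi\<^sup>2 * (\<Sum>n. c2 n * fourier_cos_coeff g (Suc n))" for g
  define D where "D g = correlation_integral h g - R g" for g
  have D_add: "D (\<lambda>t. g t + k t) = D g + D k"
    if "continuous_on UNIV g" "continuous_on UNIV k" for g k
    using that
    by (simp add: D_def R_def correlation_integral_add[OF h] fourier_cos_coeff_add distrib_left
        distrib_right suminf_add[symmetric] summable)
  have D_scale: "D (\<lambda>t. r * g t) = r * D g" if "continuous_on UNIV g" for g r
  proof -
    have "(\<Sum>n. c2 n * (r * fourier_cos_coeff g (Suc n))) = r * (\<Sum>n. c2 n * fourier_cos_coeff g (Suc n))"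
      by (subst suminf_mult[OF summable[OF that], symmetric]) (simp only: mult_ac)
    then show ?thesis
      unfolding D_def R_def correlation_integral_scale fourier_cos_coeff_scale
      by (simp add: algebra_simps)
  qed
  have D_bound: "\<bar>D g\<bar> \<le> (correlation_integral (\<lambda>t. \<bar>h t\<bar>) (\<lambda>t. 1)
      + 2 * (integral {0..2 * pi} h)\<^sup>2 + pi\<^sup>2 * (2 * suminf c2)) * B"
    if g: "continuous_on UNIV g" "\<And>t. \<bar>g t\<bar> \<le> B" for g B
  proof -
    have "\<bar>fourier_cos_coeff g 0 * (integral {0..2 * pi} h)\<^sup>2\<bar> \<le> 2 * B * (integral {0..2 * pi} h)\<^sup>2"
      using fourier_cos_coeff_bound[OF g] by (simp add: abs_mult mult_right_mono)
    moreover have "\<bar>pi\<^sup>2 * (\<Sum>n. c2 n * fourier_cos_coeff g (Suc n))\<bar> \<le> pi\<^sup>2 * (suminf c2 * (2 * B))"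
      using series(2)[OF g] by (simp add: abs_mult mult_left_mono)
    ultimately have "\<bar>R g\<bar> \<le> 2 * B * (integral {0..2 * pi} h)\<^sup>2 + pi\<^sup>2 * (suminf c2 * (2 * B))"
      unfolding R_def by linarith
    then have "\<bar>D g\<bar> \<le> correlation_integral (\<lambda>t. \<bar>h t\<bar>) (\<lambda>t. 1) * B
        + (2 * B * (integral {0..2 * pi} h)\<^sup>2 + pi\<^sup>2 * (suminf c2 * (2 * B)))"
      unfolding D_def using correlation_integral_bound[OF h g] by linarith
    then show ?thesis by (simp add: algebra_simps)
  qed
  have D_cos: "D (\<lambda>t. cos (real m * t)) = 0" for m
  proof (cases m)
    case 0
    then show ?thesis
      unfolding D_def R_def correlation_integral_cos[OF h] fourier_cos_coeff_cos by simp
  next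
    case (Suc k)
    have "(\<Sum>n. c2 n * (if Suc n = Suc k then 1 else 0)) = (\<Sum>n. if n = k then c2 n else 0)"
      by (rule suminf_cong) simp
    also have "\<dots> = c2 k"
      using sums_single[of k c2] by (rule sums_unique[symmetric])
    finally show ?thesis
      unfolding D_def R_def correlation_integral_cos[OF h] fourier_cos_coeff_cos Suc
      by (simp add: c2_def fourier_cos_coeff_def fourier_sin_coeff_def field_simps)
  qed
  have f': "continuous_on UNIV (\<lambda>t. f (- t))"
    by (intro continuous_on_compose2[OF f] continuous_intros) auto
  have "f (- (x + 2 * pi)) = f (- x)" for x
    using period[of "- x - 2 * pi"] by simp
  then have "D (\<lambda>t. f t + f (- t)) = 0"
    by (intro functional_zero_on_even_periodic[of D, OF D_add D_scale D_bound D_cos])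
       (simp_all add: f f' period continuous_on_add add.commute)
  moreover have "D (\<lambda>t. f (- t)) = D f"
    unfolding D_def R_def
    by (simp add: correlation_integral_reflect[OF h f] fourier_cos_coeff_reflect[OF f period])
  ultimately have "D f = 0" using D_add[OF f f'] by simp
  then show ?thesis
    using summable[OF f] by (simp add: D_def R_def)
qed

section \<open>Projections and the support function\<close>

lemma unit_dir_components [simp]: "unit_dir \<phi> $ 1 = cos \<phi>" "unit_dir \<phi> $ 2 = sin \<phi>"
  by (simp_all add: unit_dir_def)

lemma continuous_on_unit_dir [continuous_intros]:
  fixes g :: "'a::t2_space \<Rightarrow> real"
  assumes "continuous_on S g"
  shows "continuous_on S (\<lambda>t. unit_dir (g t))"
proof -
  have "continuous_on S (\<lambda>t. unit_dir (g t) $ i)" for i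
    using exhaust_2[of i] continuous_on_cos[OF assms] continuous_on_sin[OF assms]
    by (elim disjE) simp_all
  then have "continuous_on S (\<lambda>t. \<chi> i. unit_dir (g t) $ i)"
    by (rule continuous_on_vec_lambda)
  then show ?thesis by simp
qed

lemma inner_unit_dir_polar:
  obtains r \<theta> where "r = norm v" "\<And>\<phi>. unit_dir \<phi> \<bullet> v = r * cos (\<phi> - \<theta>)"
proof (cases "v = 0")
  case True
  then show ?thesis using that[of 0 0] by simp
next
  case False
  have "(v $ 1)\<^sup>2 + (v $ 2)\<^sup>2 = (norm v)\<^sup>2"
    unfolding power2_norm_eq_inner by (simp add: inner_vec_def sum_2 power2_eq_square)
  then have "(v $ 1 / norm v)\<^sup>2 + (v $ 2 / norm v)\<^sup>2 = 1"
    using False by (simp add: power_divide flip: add_divide_distrib)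
  then obtain t where t: "v $ 1 / norm v = cos t" "v $ 2 / norm v = sin t"
    using sincos_total_2pi by blast
  show ?thesis
  proof (rule that[of _ t])
    show "unit_dir \<phi> \<bullet> v = norm v * cos (\<phi> - t)" for \<phi>
      unfolding cos_diff t[symmetric] using False
      by (simp add: inner_vec_def sum_2 field_simps)
  qed simp
qed

lemma integral_abs_cos: "integral {0..2 * pi} (\<lambda>t. \<bar>cos t\<bar>) = 4"
proof -
  have int: "((\<lambda>t. c * cos t) has_integral (c * sin b - c * sin a)) {a..b}" if "a \<le> b" for a b c :: real
    by (rule fundamental_theorem_of_calculus[OF that])
       (auto intro!: derivative_eq_intros simp flip: has_real_derivative_iff_has_vector_derivative)
  have pos: "((\<lambda>t. \<bar>cos t\<bar>) has_integral 2) {- (pi / 2)..pi / 2}"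
  proof (rule has_integral_eq)
    show "((\<lambda>t. 1 * cos t) has_integral 2) {- (pi / 2)..pi / 2}"
      using int[of "- (pi / 2)" "pi / 2" 1] by simp
  qed (use cos_ge_zero in auto)
  have neg: "((\<lambda>t. \<bar>cos t\<bar>) has_integral 2) {pi / 2..3 / 2 * pi}"
  proof (rule has_integral_eq)
    have "sin (3 / 2 * pi) = - 1"
      using sin_3over2_pi by simp
    then show "((\<lambda>t. (- 1) * cos t) has_integral 2) {pi / 2..3 / 2 * pi}"
      using int[of "pi / 2" "3 / 2 * pi" "- 1"] by simp
    fix t assume "t \<in> {pi / 2..3 / 2 * pi}"
    then have "0 \<le> cos (t - pi)" by (intro cos_ge_zero) auto
    then show "(- 1) * cos t = \<bar>cos t\<bar>" by simp
  qed
  have "((\<lambda>t. \<bar>cos t\<bar>) has_integral 2 + 2) {- (pi / 2)..3 / 2 * pi}"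
    by (rule has_integral_combine[OF _ _ pos neg]) auto
  then have "integral {- (pi / 2)..- (pi / 2) + 2 * pi} (\<lambda>t. \<bar>cos t\<bar>) = 4"
    by (auto simp: algebra_simps dest: integral_unique)
  then show ?thesis
    by (subst (asm) integral_over_period) (auto intro!: continuous_intros)
qed

text \<open>In polar coordinates the projection of \<open>v\<close> in the direction \<open>\<phi>\<close> is \<open>norm v * cos (\<phi> - \<theta>)\<close>.\<close>

lemma norm_eq_mean_projection:
  "integral {0..2 * pi} (\<lambda>\<phi>. \<bar>unit_dir \<phi> \<bullet> v\<bar>) = 4 * norm v"
proof -
  obtain r \<theta> where r: "r = norm v" and polar: "\<And>\<phi>. unit_dir \<phi> \<bullet> v = r * cos (\<phi> - \<theta>)"
    using inner_unit_dir_polar[of v] by blast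
  have "integral {0..2 * pi} (\<lambda>\<phi>. \<bar>cos (\<phi> - \<theta>)\<bar>) = integral {- \<theta>..- \<theta> + 2 * pi} (\<lambda>t. \<bar>cos t\<bar>)"
    using integral_shift_Icc_real[of 0 "2 * pi" "\<lambda>t. \<bar>cos t\<bar>" "- \<theta>"] by (simp add: comp_def add.commute)
  also have "\<dots> = 4"
    by (subst integral_over_period) (auto intro!: continuous_intros simp: integral_abs_cos)
  finally show ?thesis
    using r by (simp add: polar abs_mult)
qed

lemma inner_unit_dir_le_support_fun:
  assumes "compact K" "x \<in> K"
  shows "unit_dir \<phi> \<bullet> x \<le> support_fun K \<phi>"
  unfolding support_fun_def
proof (rule cSUP_upper[OF assms(2)])
  have "compact ((\<lambda>x. unit_dir \<phi> \<bullet> x) ` K)"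
    by (intro compact_continuous_image continuous_intros assms)
  then show "bdd_above ((\<lambda>x. unit_dir \<phi> \<bullet> x) ` K)"
    by (intro bounded_imp_bdd_above compact_imp_bounded)
qed

lemma support_fun_eqI:
  assumes "b \<in> K" "unit_dir \<phi> \<bullet> b = M" "\<And>x. x \<in> K \<Longrightarrow> unit_dir \<phi> \<bullet> x \<le> M"
  shows "support_fun K \<phi> = M"
  unfolding support_fun_def using assms by (intro cSup_eq_maximum) auto

lemma support_fun_attained:
  assumes "compact K" "K \<noteq> {}"
  obtains b where "b \<in> K" "unit_dir \<phi> \<bullet> b = support_fun K \<phi>"
proof -
  obtain b where "b \<in> K" "\<And>x. x \<in> K \<Longrightarrow> unit_dir \<phi> \<bullet> x \<le> unit_dir \<phi> \<bullet> b"
    using continuous_attains_sup[OF assms continuous_on_inner[OF continuous_on_const continuous_on_id]]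
    by blast
  then show ?thesis using that support_fun_eqI by metis
qed

lemma support_fun_periodic: "support_fun K (\<phi> + 2 * pi) = support_fun K \<phi>"
  by (simp add: support_fun_def unit_dir_def)

lemma unit_dir_add_pi: "unit_dir (\<phi> + pi) = - unit_dir \<phi>"
  by (simp add: vec_eq_iff forall_2)

text \<open>If \<open>norm x \<le> R\<close> on \<open>K\<close>, moving the unit normal by a vector of norm \<open>d\<close> changes the support
  function by at most \<open>d * R\<close>.\<close>

lemma continuous_support_fun:
  assumes "compact K" "K \<noteq> {}"
  shows "continuous_on S (support_fun K)"
proof -
  obtain R where R: "\<And>x. x \<in> K \<Longrightarrow> norm x \<le> R"
    using compact_imp_bounded[OF assms(1)] by (auto simp: bounded_iff)
  have le: "support_fun K \<phi> \<le> support_fun K \<psi> + norm (unit_dir \<phi> - unit_dir \<psi>) * R" for \<phi> \<psi>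
  proof -
    obtain b where b: "b \<in> K" "unit_dir \<phi> \<bullet> b = support_fun K \<phi>"
      using support_fun_attained[OF assms] by blast
    have "unit_dir \<phi> \<bullet> b = unit_dir \<psi> \<bullet> b + (unit_dir \<phi> - unit_dir \<psi>) \<bullet> b"
      by (simp add: inner_diff_left)
    also have "\<dots> \<le> support_fun K \<psi> + norm (unit_dir \<phi> - unit_dir \<psi>) * norm b"
      using inner_unit_dir_le_support_fun[OF assms(1) b(1)] norm_cauchy_schwarz by (rule add_mono)
    also have "\<dots> \<le> support_fun K \<psi> + norm (unit_dir \<phi> - unit_dir \<psi>) * R"
      using R[OF b(1)] by (simp add: mult_left_mono)
    finally show ?thesis using b(2) by simp
  qed
  have "isCont (support_fun K) \<phi>" for \<phi>
  proof -
    have "continuous_on UNIV unit_dir" by (intro continuous_intros)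
    then have "isCont unit_dir \<phi>" by (simp add: continuous_on_eq_continuous_at)
    then have "((\<lambda>\<psi>. norm (unit_dir \<psi> - unit_dir \<phi>) * R) \<longlongrightarrow> norm (unit_dir \<phi> - unit_dir \<phi>) * R) (at \<phi>)"
      unfolding isCont_def by (intro tendsto_intros)
    then have lim: "((\<lambda>\<psi>. norm (unit_dir \<psi> - unit_dir \<phi>) * R) \<longlongrightarrow> 0) (at \<phi>)" by simp
    have "norm (support_fun K \<psi> - support_fun K \<phi>) \<le> norm (unit_dir \<psi> - unit_dir \<phi>) * R" for \<psi>
      using le[of \<psi> \<phi>] le[of \<phi> \<psi>, unfolded norm_minus_commute[of "unit_dir \<phi>"]]
      unfolding real_norm_def by linarith
    then have "((\<lambda>\<psi>. support_fun K \<psi> - support_fun K \<phi>) \<longlongrightarrow> 0) (at \<phi>)"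
      by (intro Lim_null_comparison[OF always_eventually lim] allI)
    then show ?thesis by (simp add: isCont_def LIM_zero_iff)
  qed
  then show ?thesis by (simp add: continuous_at_imp_continuous_on)
qed

section \<open>Cauchy's formula for the length of a convex curve\<close>

text \<open>A line through an interior point \<open>z\<close> meets the boundary of a convex set at most twice: of three
  points on the line, the middle one lies strictly between \<open>z\<close> and an outer one, and is therefore
  interior.\<close>

lemma frontier_level_at_most_two:
  fixes K :: "(real ^ 2) set" and \<phi> c :: real
  defines "Q \<equiv> {x \<in> frontier K. unit_dir \<phi> \<bullet> x = c}"
  assumes K: "convex K" and z: "z \<in> interior K" "unit_dir \<phi> \<bullet> z = c"
    and distinct: "p1 \<noteq> p2" "p2 \<noteq> p3" "p1 \<noteq> p3"
    and Q: "p1 \<in> Q" "p2 \<in> Q" "p3 \<in> Q"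
  shows False
proof -
  \<comment> \<open>The direction of the line; \<open>v \<bullet> x\<close> orders its points.\<close>
  define v where "v = unit_dir (\<phi> + pi / 2)"
  have v: "v $ 1 = - sin \<phi>" "v $ 2 = cos \<phi>"
    by (simp_all add: v_def cos_add sin_add)
  have decomp: "x = (unit_dir \<phi> \<bullet> x) *\<^sub>R unit_dir \<phi> + (v \<bullet> x) *\<^sub>R v" for x
  proof -
    have "a = (cos \<phi> * a + sin \<phi> * b) * cos \<phi> - (cos \<phi> * b - sin \<phi> * a) * sin \<phi>"
      and "b = (cos \<phi> * a + sin \<phi> * b) * sin \<phi> + (cos \<phi> * b - sin \<phi> * a) * cos \<phi>" for a b
      using sin_cos_squared_add[of \<phi>] by algebra+
    from this(1)[of "x $ 1" "x $ 2"] this(2)[of "x $ 2" "x $ 1"] show ?thesis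
      unfolding vec_eq_iff forall_2 inner_vec_def sum_2 by (simp add: v)
  qed
  have eqI: "x = y" if "unit_dir \<phi> \<bullet> x = c" "unit_dir \<phi> \<bullet> y = c" "v \<bullet> x = v \<bullet> y" for x y
    using decomp[of x] decomp[of y] that by simp
  have no_middle: False
    if q: "q \<in> Q" "p \<in> Q" and between: "v \<bullet> p < v \<bullet> q \<and> v \<bullet> q \<le> v \<bullet> z \<or> v \<bullet> z \<le> v \<bullet> q \<and> v \<bullet> q < v \<bullet> p"
    for p q
  proof -
    have "q \<notin> interior K" using q(1) by (simp add: Q_def frontier_def)
    then have "v \<bullet> q \<noteq> v \<bullet> z" using eqI[of q z] q(1) z by (auto simp: Q_def)
    define t where "t = (v \<bullet> q - v \<bullet> z) / (v \<bullet> p - v \<bullet> z)"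
    have t: "0 < t" "t < 1"
      using between \<open>v \<bullet> q \<noteq> v \<bullet> z\<close> by (auto simp: t_def divide_simps)
    have "v \<bullet> q = v \<bullet> ((1 - t) *\<^sub>R z + t *\<^sub>R p)"
    proof -
      have "t * (v \<bullet> p - v \<bullet> z) = v \<bullet> q - v \<bullet> z"
        using between by (auto simp: t_def)
      then show ?thesis by (simp add: inner_add_right algebra_simps)
    qed
    moreover have "unit_dir \<phi> \<bullet> ((1 - t) *\<^sub>R z + t *\<^sub>R p) = c"
      using q(2) z by (simp add: Q_def inner_add_right algebra_simps)
    ultimately have "q = (1 - t) *\<^sub>R z + t *\<^sub>R p"
      using q(1) by (intro eqI) (auto simp: Q_def)
    moreover have "z \<noteq> p"
      using between \<open>v \<bullet> q \<noteq> v \<bullet> z\<close> by auto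
    ultimately have "q \<in> open_segment z p"
      using t by (auto simp: in_segment)
    moreover have "p \<in> closure K" using q(2) by (simp add: Q_def frontier_def)
    ultimately have "q \<in> interior K"
      using in_interior_closure_convex_segment[OF K z(1)] by blast
    with \<open>q \<notin> interior K\<close> show False by blast
  qed
  have no_three: False
    if "p \<in> Q" "q \<in> Q" "r \<in> Q" "v \<bullet> p < v \<bullet> q" "v \<bullet> q < v \<bullet> r" for p q r
    using no_middle[of q p] no_middle[of q r] that by (cases "v \<bullet> q \<le> v \<bullet> z") auto
  have "x = y" if "x \<in> Q" "y \<in> Q" "v \<bullet> x = v \<bullet> y" for x y
    using that by (intro eqI) (auto simp: Q_def)
  then have neq: "v \<bullet> p1 \<noteq> v \<bullet> p2" "v \<bullet> p2 \<noteq> v \<bullet> p3" "v \<bullet> p1 \<noteq> v \<bullet> p3"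
    using Q distinct by auto
  show False
    using neq no_three[OF Q(1,2,3)] no_three[OF Q(1,3,2)] no_three[OF Q(2,1,3)]
      no_three[OF Q(2,3,1)] no_three[OF Q(3,1,2)] no_three[OF Q(3,2,1)]
    unfolding neq_iff by blast
qed

text \<open>A descent \<open>w x > w y\<close> with \<open>x < y\<close>, combined with the climbs from \<open>w a\<close> to \<open>w x\<close> and from
  \<open>w y\<close> to \<open>w b\<close>, makes \<open>w\<close> take the values between \<open>w y\<close> and \<open>w x\<close> three times.\<close>

lemma mono_on_if_levels_few:
  fixes w :: "real \<Rightarrow> real"
  assumes cont: "continuous_on {a..b} w"
    and range: "\<And>t. t \<in> {a..b} \<Longrightarrow> w a \<le> w t \<and> w t \<le> w b"
    and levels: "\<And>t1 t2 t3. \<lbrakk>a < t1; t1 < t2; t2 < t3; t3 < b; w t1 = w t2; w t2 = w t3;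
      w a < w t2; w t2 < w b\<rbrakk> \<Longrightarrow> False"
  shows "mono_on {a..b} w"
proof (rule mono_onI, rule ccontr)
  fix x y assume xy: "x \<in> {a..b}" "y \<in> {a..b}" "x \<le> y" "\<not> w x \<le> w y"
  then obtain c where c: "w y < c" "c < w x" using dense[of "w y" "w x"] by auto
  have sub: "continuous_on {p..q} w" if "a \<le> p" "q \<le> b" for p q
    using cont by (rule continuous_on_subset) (use that in auto)
  obtain t1 where t1: "a \<le> t1" "t1 \<le> x" "w t1 = c"
    using IVT'[of w a c x] sub[of a x] c xy range[of y] by auto
  obtain t2 where t2: "x \<le> t2" "t2 \<le> y" "w t2 = c"
    using IVT2'[of w y c x] sub[of x y] c xy by auto
  obtain t3 where t3: "y \<le> t3" "t3 \<le> b" "w t3 = c"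
    using IVT'[of w y c b] sub[of y b] c xy range[of x] by auto
  have bounds: "w a < c" "c < w b" using range[of x] range[of y] c xy by auto
  have "t1 \<noteq> x" "t2 \<noteq> x" "t2 \<noteq> y" "t3 \<noteq> y" "t1 \<noteq> a" "t3 \<noteq> b"
    using t1 t2 t3 c bounds by auto
  then show False
    using levels[of t1 t2 t3] t1 t2 t3 bounds by force
qed

lemma integral_abs_deriv_mono:
  fixes w :: "real \<Rightarrow> real"
  assumes "a \<le> b" and deriv: "\<And>t. (w has_real_derivative w' t) (at t)" and mono: "mono_on {a..b} w"
  shows "((\<lambda>t. \<bar>w' t\<bar>) has_integral w b - w a) {a..b}"
proof (rule has_integral_spike_finite)
  show "(w' has_integral w b - w a) {a..b}"
    using deriv by (intro fundamental_theorem_of_calculus[OF \<open>a \<le> b\<close>])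
      (simp add: has_real_derivative_iff_has_vector_derivative has_vector_derivative_at_within)
  show "\<bar>w' t\<bar> = w' t" if "t \<in> {a..b} - {a, b}" for t
    using mono_on_imp_deriv_nonneg[OF mono deriv, of t] that by simp
qed simp

text \<open>A minimum point \<open>s0\<close> and a maximum point cut the period into two arcs.  Since no
  intermediate value is taken three times, \<open>w\<close> climbs monotonically on the first arc and descends
  monotonically on the second, so that each contributes the oscillation of \<open>w\<close>.\<close>

lemma periodic_total_variation:
  fixes w :: "real \<Rightarrow> real"
  assumes deriv: "\<And>t. (w has_real_derivative w' t) (at t)" and cont: "continuous_on UNIV w'"
    and period: "\<And>t. w (t + 1) = w t" "\<And>t. w' (t + 1) = w' t"
    and min: "\<And>t. w s0 \<le> w t" and max: "\<And>t. w t \<le> w s1"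
    and levels: "\<And>t1 t2 t3. \<lbrakk>t1 < t2; t2 < t3; t3 < t1 + 1; w t1 = w t2; w t2 = w t3;
      w s0 < w t2; w t2 < w s1\<rbrakk> \<Longrightarrow> False"
  shows "integral {0..1} (\<lambda>t. \<bar>w' t\<bar>) = 2 * (w s1 - w s0)"
proof -
  interpret periodic_fun_simple' w by standard (rule period)
  \<comment> \<open>The maximum point in the period that starts at \<open>s0\<close>.\<close>
  define r where "r = s0 + frac (s1 - s0)"
  have r: "s0 \<le> r" "r < s0 + 1" by (simp_all add: r_def frac_lt_1)
  have wr: "w r = w s1"
    using minus_of_int[of s1 "\<lfloor>s1 - s0\<rfloor>"] by (simp add: r_def frac_def)
  have cont_w: "continuous_on S w" for S
    using deriv by (meson DERIV_isCont continuous_at_imp_continuous_on)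
  have up: "mono_on {s0..r} w"
  proof (rule mono_on_if_levels_few[OF cont_w])
    fix t1 t2 t3 assume *: "s0 < t1" "t1 < t2" "t2 < t3" "t3 < r" "w t1 = w t2" "w t2 = w t3"
      "w s0 < w t2" "w t2 < w r"
    then have "t3 < t1 + 1" using r by linarith
    with * wr show False by (intro levels[of t1 t2 t3]) simp_all
  qed (use min max wr in simp)
  have down: "mono_on {r..s0 + 1} (\<lambda>t. - w t)"
  proof (rule mono_on_if_levels_few)
    fix t1 t2 t3 assume *: "r < t1" "t1 < t2" "t2 < t3" "t3 < s0 + 1" "- w t1 = - w t2"
      "- w t2 = - w t3" "- w r < - w t2" "- w t2 < - w (s0 + 1)"
    then have "t3 < t1 + 1" using r by linarith
    with * wr period(1)[of s0] show False by (intro levels[of t1 t2 t3]) simp_all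
  qed (use min max wr period(1)[of s0] in \<open>auto intro!: continuous_intros cont_w\<close>)
  have "((\<lambda>t. \<bar>w' t\<bar>) has_integral w r - w s0) {s0..r}"
    using r by (intro integral_abs_deriv_mono deriv up) simp
  moreover have "((\<lambda>t. \<bar>- w' t\<bar>) has_integral - w (s0 + 1) - - w r) {r..s0 + 1}"
    using r by (intro integral_abs_deriv_mono[where w = "\<lambda>t. - w t"] DERIV_minus deriv down) simp
  then have "((\<lambda>t. \<bar>w' t\<bar>) has_integral - w (s0 + 1) - - w r) {r..s0 + 1}"
    by simp
  ultimately have "((\<lambda>t. \<bar>w' t\<bar>) has_integral (w r - w s0) + (- w (s0 + 1) - - w r)) {s0..s0 + 1}"
    using r by (intro has_integral_combine[of s0 r "s0 + 1"]) simp_all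
  then have "integral {s0..s0 + 1} (\<lambda>t. \<bar>w' t\<bar>) = 2 * (w s1 - w s0)"
    by (simp add: integral_unique wr period)
  moreover have "integral {s0..s0 + 1} (\<lambda>t. \<bar>w' t\<bar>) = integral {0..1} (\<lambda>t. \<bar>w' t\<bar>)"
    by (rule integral_over_period) (auto intro!: continuous_intros cont simp: period)
  ultimately show ?thesis by simp
qed

text \<open>Injectivity on \<open>{0..<1}\<close> carries over to every half-open interval of length 1; the arcs
  between extrema of a projection do not respect the parameter interval.\<close>

lemma simple_loop_inj:
  fixes g :: "real \<Rightarrow> 'a::topological_space"
  assumes period: "\<And>t. g (t + 1) = g t" and "simple_path g"
    and "g x = g y" "\<bar>x - y\<bar> < 1"
  shows "x = y"
proof -
  interpret periodic_fun_simple' g by standard (rule period)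
  have frac: "g (frac t) = g t" for t
    using minus_of_int[of t "\<lfloor>t\<rfloor>"] by (simp add: frac_def)
  have range: "0 \<le> frac t" "frac t < 1" for t :: real
    by (simp_all add: frac_lt_1)
  have "loop_free g" "g (frac x) = g (frac y)" "frac x \<in> {0..1}" "frac y \<in> {0..1}"
    using \<open>simple_path g\<close> range[of x] range[of y] frac[of x] frac[of y] \<open>g x = g y\<close>
    by (simp_all add: simple_path_def)
  then have "frac x = frac y \<or> frac x = 1 \<or> frac y = 1"
    unfolding loop_free_def by blast
  then have "frac x = frac y" using range[of x] range[of y] by auto
  then obtain n where n: "x - y = of_int n"
    unfolding frac_def by (metis add_diff_cancel_left' diff_add_cancel diff_diff_eq2 of_int_diff)
  with \<open>\<bar>x - y\<bar> < 1\<close> have "n = 0" by linarith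
  with n show ?thesis by simp
qed

text \<open>The projection of the boundary curve to the direction \<open>\<phi>\<close> runs once from the minimum to the
  maximum and back.  A value strictly in between is attained at an interior point of \<open>K\<close>, so that
  the corresponding line meets the curve at most twice.\<close>

lemma projection_total_variation:
  fixes K :: "(real ^ 2) set" and g g' :: "real \<Rightarrow> real ^ 2"
  assumes K: "compact K" "convex K" "0 \<in> interior K"
    and period: "\<And>t. g (t + 1) = g t" and simple: "simple_path g"
    and image: "path_image g = frontier K"
    and deriv: "\<And>t. (g has_vector_derivative g' t) (at t)" and cont: "continuous_on UNIV g'"
  shows "integral {0..1} (\<lambda>t. \<bar>unit_dir \<phi> \<bullet> g' t\<bar>)
    = 2 * (support_fun K \<phi> + support_fun K (\<phi> + pi))"
proof -
  interpret periodic_fun_simple' g by standard (rule period)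
  define w where "w t = unit_dir \<phi> \<bullet> g t" for t
  have frontier: "frontier K = range g"
  proof -
    have "g t \<in> frontier K" for t
      using minus_of_int[of t "\<lfloor>t\<rfloor>"] image unfolding path_image_def
      by (metis atLeastAtMost_iff frac_def frac_ge_0 frac_lt_1 image_eqI less_eq_real_def)
    moreover have "frontier K \<subseteq> range g" unfolding image[symmetric] path_image_def by auto
    ultimately show ?thesis by blast
  qed
  have "compact (frontier K)" using K(1) by (rule compact_frontier)
  moreover have "frontier K \<noteq> {}" using frontier by auto
  ultimately obtain p q where p: "p \<in> frontier K" "\<And>x. x \<in> frontier K \<Longrightarrow> unit_dir \<phi> \<bullet> p \<le> unit_dir \<phi> \<bullet> x"
    and q: "q \<in> frontier K" "\<And>x. x \<in> frontier K \<Longrightarrow> unit_dir \<phi> \<bullet> x \<le> unit_dir \<phi> \<bullet> q"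
    using continuous_attains_sup[OF _ _ continuous_on_inner[OF continuous_on_const continuous_on_id]]
      continuous_attains_inf[OF _ _ continuous_on_inner[OF continuous_on_const continuous_on_id]]
    by metis
  obtain s0 s1 where s: "g s0 = p" "g s1 = q" using p(1) q(1) frontier by auto
  \<comment> \<open>A compact convex set is the hull of its frontier, so that linear bounds on the frontier hold
    on the whole set.\<close>
  have hull: "K \<subseteq> H" if "frontier K \<subseteq> H" "convex H" for H
    using hull_minimal[of "frontier K" H convex] that Krein_Milman_frontier[OF K(2,1)] by simp
  have lower: "unit_dir \<phi> \<bullet> p \<le> unit_dir \<phi> \<bullet> x" if "x \<in> K" for x
    using hull[OF _ convex_halfspace_ge[of "unit_dir \<phi> \<bullet> p" "unit_dir \<phi>"]] p(2) that by auto
  have upper: "unit_dir \<phi> \<bullet> x \<le> unit_dir \<phi> \<bullet> q" if "x \<in> K" for x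
    using hull[OF _ convex_halfspace_le[of "unit_dir \<phi>" "unit_dir \<phi> \<bullet> q"]] q(2) that by auto
  have pqK: "p \<in> K" "q \<in> K"
    using p(1) q(1) K(1) frontier_subset_closed compact_imp_closed by blast+
  have sup: "support_fun K \<phi> = w s1" "support_fun K (\<phi> + pi) = - w s0"
    by (rule support_fun_eqI[of q]; use pqK upper s in \<open>simp add: w_def\<close>)
      (rule support_fun_eqI[of p]; use pqK lower s in \<open>simp add: w_def unit_dir_add_pi\<close>)
  have interior_level: "\<exists>z\<in>interior K. unit_dir \<phi> \<bullet> z = c" if "w s0 < c" "c < w s1" for c
  proof -
    \<comment> \<open>Points of \<open>K\<close> are scaled towards the origin: the maximum point reaches
      the levels \<open>c \<ge> 0\<close>, the minimum point the levels \<open>c < 0\<close>.\<close>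
    have *: "\<exists>z\<in>interior K. unit_dir \<phi> \<bullet> z = c"
      if x: "x \<in> K" "0 \<le> c / (unit_dir \<phi> \<bullet> x)" "c / (unit_dir \<phi> \<bullet> x) < 1" "unit_dir \<phi> \<bullet> x \<noteq> 0" for x
    proof
      let ?r = "c / (unit_dir \<phi> \<bullet> x)"
      have "x - (1 - ?r) *\<^sub>R (x - 0) \<in> interior K"
        using x by (intro mem_interior_convex_shrink K) auto
      then show "?r *\<^sub>R x \<in> interior K" by (simp add: algebra_simps)
      show "unit_dir \<phi> \<bullet> (?r *\<^sub>R x) = c" using x by simp
    qed
    show ?thesis
    proof (cases "0 \<le> c")
      case True
      then show ?thesis using *[OF pqK(2)] that s by (simp add: w_def)
    next
      case False
      then show ?thesis using *[OF pqK(1)] that s by (simp add: w_def divide_less_eq divide_nonpos_neg)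
    qed
  qed
  have "integral {0..1} (\<lambda>t. \<bar>unit_dir \<phi> \<bullet> g' t\<bar>) = 2 * (w s1 - w s0)"
  proof (rule periodic_total_variation[where w = w and w' = "\<lambda>t. unit_dir \<phi> \<bullet> g' t"])
    show "(w has_real_derivative unit_dir \<phi> \<bullet> g' t) (at t)" for t
      unfolding w_def has_real_derivative_iff_has_vector_derivative
      by (rule bounded_linear.has_vector_derivative[OF bounded_linear_inner_right deriv])
    show "w (t + 1) = w t" for t by (simp add: w_def period)
    have "(g has_vector_derivative g' (t + 1)) (at t)" for t
    proof -
      have "((\<lambda>x. g (x + 1)) has_vector_derivative g' (t + 1)) (at t)"
        using vector_diff_chain_at[of "\<lambda>x. x + 1" 1 t g "g' (t + 1)"] deriv[of "t + 1"]
        by (simp add: comp_def has_vector_derivative_add_const)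
      then show ?thesis by (simp add: period)
    qed
    then have "g' (t + 1) = g' t" for t
      using deriv vector_derivative_unique_at by blast
    then show "unit_dir \<phi> \<bullet> g' (t + 1) = unit_dir \<phi> \<bullet> g' t" for t by simp
    show "w s0 \<le> w t" "w t \<le> w s1" for t
      using p(2) q(2) s frontier by (auto simp: w_def)
    fix t1 t2 t3
    assume t: "t1 < t2" "t2 < t3" "t3 < t1 + 1" "w t1 = w t2" "w t2 = w t3" "w s0 < w t2" "w t2 < w s1"
    obtain z where z: "z \<in> interior K" "unit_dir \<phi> \<bullet> z = w t2"
      using interior_level t by blast
    have ne: "g x \<noteq> g y" if "x < y" "y < x + 1" for x y
      using simple_loop_inj[OF period simple, of x y] that by auto
    show False
      using frontier t ne
      by (intro frontier_level_at_most_two[OF K(2) z, of "g t1" "g t2" "g t3"]) (auto simp: w_def)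
  qed (intro continuous_intros cont)
  then show ?thesis by (simp add: sup)
qed

text \<open>Four times the speed of the curve is the integral of \<open>\<bar>unit_dir \<phi> \<bullet> g' t\<bar>\<close> over all directions.  After
  the exchange of the integrals, the inner one is the total variation of a projection, which is
  twice the width of \<open>K\<close> in the direction \<open>\<phi>\<close>; and the width integrates to twice the integral
  of the support function.\<close>

lemma cauchy_length_formula:
  fixes K :: "(real ^ 2) set"
  assumes K: "compact K" "convex K" "0 \<in> interior K" and "C2_boundary_of_length K L"
  shows "integral {0..2 * pi} (support_fun K) = L"
proof -
  obtain g where g: "regular_C2_loop g" "simple_path g" "path_image g = frontier K" "curve_length g = L"
    using assms(4) by (auto simp: C2_boundary_of_length_def)
  define g' where "g' t = vector_derivative g (at t)" for t
  have deriv: "(g has_vector_derivative g' t) (at t)" for t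
    using g(1) unfolding regular_C2_loop_def C1_differentiable_on_eq g'_def
    by (simp add: vector_derivative_works)
  have cont: "continuous_on UNIV g'"
    using g(1) unfolding regular_C2_loop_def C1_differentiable_on_eq g'_def by simp
  have period: "g (t + 1) = g t" for t using g(1) by (simp add: regular_C2_loop_def)
  have "K \<noteq> {}" using K(3) interior_subset by blast
  note h_cont = continuous_support_fun[OF K(1) this]
  have "4 * L = integral {0..1} (\<lambda>t. integral {0..2 * pi} (\<lambda>\<phi>. \<bar>unit_dir \<phi> \<bullet> g' t\<bar>))"
    using g(4) by (simp add: norm_eq_mean_projection curve_length_def g'_def)
  also have "\<dots> = integral {0..2 * pi} (\<lambda>\<phi>. integral {0..1} (\<lambda>t. \<bar>unit_dir \<phi> \<bullet> g' t\<bar>))"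
  proof -
    have "continuous_on (cbox (0, 0) (1, 2 * pi)) (\<lambda>(t, \<phi>). \<bar>unit_dir \<phi> \<bullet> g' t\<bar>)"
      unfolding case_prod_unfold
      by (intro continuous_intros continuous_on_compose2[OF cont]) auto
    from integral_swap_continuous[OF this] show ?thesis by simp
  qed
  also have "\<dots> = integral {0..2 * pi} (\<lambda>\<phi>. 2 * support_fun K \<phi> + 2 * support_fun K (\<phi> + pi))"
    by (simp add: projection_total_variation[OF K period g(2,3) deriv cont] distrib_left)
  also have "\<dots> = 2 * integral {0..2 * pi} (support_fun K)
      + 2 * integral {0..2 * pi} (\<lambda>\<phi>. support_fun K (\<phi> + pi))"
    by (subst Henstock_Kurzweil_Integration.integral_add)
       (auto intro!: integrable_continuous_real continuous_intros continuous_on_compose2[OF h_cont])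
  also have "integral {0..2 * pi} (\<lambda>\<phi>. support_fun K (\<phi> + pi))
      = integral {pi..pi + 2 * pi} (support_fun K)"
    using integral_shift_Icc_real[of 0 "2 * pi" "support_fun K" pi] by (simp add: comp_def add.commute)
  also have "\<dots> = integral {0..2 * pi} (support_fun K)"
    by (rule integral_over_period) (simp_all add: h_cont support_fun_periodic)
  finally show ?thesis by simp
qed

section \<open>Integration over the lines that meet a convex set\<close>

text \<open>The segment from the origin to a point of \<open>K\<close> where the support function is attained crosses
  every line with this normal direction and a smaller distance.\<close>

lemma polar_line_meets_iff:
  assumes K: "compact K" "convex K" "0 \<in> K" and "p > 0"
  shows "polar_line (p, \<phi>) \<inter> K \<noteq> {} \<longleftrightarrow> p \<le> support_fun K \<phi>"
proof
  assume "polar_line (p, \<phi>) \<inter> K \<noteq> {}"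
  then show "p \<le> support_fun K \<phi>"
    using inner_unit_dir_le_support_fun[OF K(1)] by (auto simp: polar_line_def)
next
  assume le: "p \<le> support_fun K \<phi>"
  obtain b where b: "b \<in> K" "unit_dir \<phi> \<bullet> b = support_fun K \<phi>"
    using support_fun_attained[OF K(1)] K(3) by blast
  define r where "r = p / support_fun K \<phi>"
  have "0 \<le> r" "r \<le> 1" "r * support_fun K \<phi> = p"
    using le \<open>p > 0\<close> by (auto simp: r_def)
  then have "r *\<^sub>R b \<in> K" "unit_dir \<phi> \<bullet> (r *\<^sub>R b) = p"
    using b convexD[OF K(2,3) b(1), of "1 - r" r] by simp_all
  moreover from this(2) have "r *\<^sub>R b \<in> polar_line (p, \<phi>)"
    unfolding polar_line_def by simp
  ultimately show "polar_line (p, \<phi>) \<inter> K \<noteq> {}" by blast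
qed

text \<open>The measure theory is carried out for an arbitrary continuous bound \<open>h\<close>; \<open>K\<close> enters only
  through its support function.\<close>

definition lines_below :: "(real \<Rightarrow> real) \<Rightarrow> (real \<times> real) set"
  where "lines_below h = {G \<in> {0<..} \<times> {0..<2 * pi}. fst G \<le> h (snd G)}"

lemma space_line_measure: "space line_measure = {0<..} \<times> {0..<2 * pi}"
  by (simp add: line_measure_def space_restrict_space)

lemma line_pairs_meeting_eq:
  assumes K: "compact K" "convex K" "0 \<in> K"
  shows "line_pairs_meeting K = lines_below (support_fun K) \<times> lines_below (support_fun K)"
proof -
  have "lines_below (support_fun K) = {G \<in> space line_measure. polar_line G \<inter> K \<noteq> {}}"
  proof -
    have "0 < fst G \<longrightarrow> (polar_line G \<inter> K \<noteq> {} \<longleftrightarrow> fst G \<le> support_fun K (snd G))" for G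
      using polar_line_meets_iff[OF K, of "fst G" "snd G"] unfolding prod.collapse by blast
    then show ?thesis
      unfolding lines_below_def space_line_measure mem_Times_iff greaterThan_iff
      by (intro Collect_cong) metis
  qed
  then show ?thesis
    by (auto simp: line_pairs_meeting_def space_pair_measure)
qed

lemma line_domain_borel: "{0<..} \<times> {0..<2 * pi} \<in> sets (borel :: (real \<times> real) measure)"
  unfolding borel_prod[symmetric] by (rule pair_measureI) simp_all

lemma sigma_finite_line_measure: "sigma_finite_measure line_measure"
  unfolding line_measure_def
  by (rule sigma_finite_measure_restrict_space) (simp_all add: line_domain_borel sigma_finite_lborel)

lemma borel_measurable_line_measure:
  "f \<in> borel_measurable borel \<Longrightarrow> f \<in> borel_measurable line_measure"
  by (simp add: line_measure_def measurable_restrict_space1)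

lemma lines_below_borel:
  assumes h: "continuous_on UNIV h"
  shows "lines_below h \<in> sets borel"
proof -
  have "closed {G. fst G \<le> h (snd G)}"
    by (intro closed_Collect_le continuous_intros continuous_on_compose2[OF h]) auto
  then have "{0<..} \<times> {0..<2 * pi} \<inter> {G. fst G \<le> h (snd G)} \<in> sets borel"
    by (rule sets.Int[OF line_domain_borel borel_closed])
  moreover have "lines_below h = {0<..} \<times> {0..<2 * pi} \<inter> {G. fst G \<le> h (snd G)}"
    by (auto simp: lines_below_def)
  ultimately show ?thesis by simp
qed

lemma lines_below_measurable:
  assumes "continuous_on UNIV h"
  shows "lines_below h \<in> sets line_measure"
  using lines_below_borel[OF assms]
  by (auto simp: line_measure_def sets_restrict_space_iff line_domain_borel lines_below_def)

lemma emeasure_lines_below_finite: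
  assumes h: "continuous_on UNIV h"
  shows "emeasure line_measure (lines_below h) < \<infinity>"
proof -
  have "compact (h ` {0..2 * pi})"
    using h by (intro compact_continuous_image) (auto intro: continuous_on_subset)
  then have "bounded (h ` {0..2 * pi})" by (rule compact_imp_bounded)
  then obtain B where B: "\<forall>y \<in> h ` {0..2 * pi}. norm y \<le> B"
    unfolding bounded_iff ..
  have "lines_below h \<subseteq> cbox (0, 0) (B, 2 * pi)"
  proof
    fix G assume "G \<in> lines_below h"
    then have G: "0 < fst G" "fst G \<le> h (snd G)" "snd G \<in> {0..2 * pi}"
      by (auto simp: lines_below_def)
    have "h (snd G) \<le> B" using bspec[OF B imageI[OF G(3)]] by simp
    with G show "G \<in> cbox (0, 0) (B, 2 * pi)"
      by (cases G) (auto simp: cbox_Pair_eq)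
  qed
  then have "emeasure lborel (lines_below h) \<le> emeasure lborel (cbox (0::real, 0::real) (B, 2 * pi))"
    by (intro emeasure_mono) simp_all
  also have "\<dots> < \<infinity>" by (rule emeasure_lborel_cbox_finite)
  finally show ?thesis
    unfolding line_measure_def
    by (subst emeasure_restrict_space) (auto simp: line_domain_borel lines_below_def)
qed

text \<open>For fixed \<open>\<phi>\<close> the distances run through \<open>{0<..h \<phi>}\<close>, which contributes the factor
  \<open>h \<phi>\<close>.\<close>

lemma lines_below_integral:
  fixes h g :: "real \<Rightarrow> real"
  assumes h: "continuous_on UNIV h" and pos: "\<And>\<phi>. 0 \<le> h \<phi>" and g: "continuous_on UNIV g"
  shows "(LINT G|line_measure. indicator (lines_below h) G * g (snd G))
    = integral {0..2 * pi} (\<lambda>\<phi>. h \<phi> * g \<phi>)"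
proof -
  have hg: "continuous_on S (\<lambda>\<phi>. h \<phi> * g \<phi>)" for S
    using h g by (intro continuous_intros) (auto intro: continuous_on_subset)
  let ?F = "\<lambda>G. indicator (lines_below h) G * g (snd G)"
  have "compact (g ` {0..2 * pi})"
    using g by (intro compact_continuous_image) (auto intro: continuous_on_subset)
  then have "bounded (g ` {0..2 * pi})" by (rule compact_imp_bounded)
  then obtain B where B: "\<forall>y \<in> g ` {0..2 * pi}. norm y \<le> B"
    unfolding bounded_iff ..
  have emeasure: "emeasure lborel (lines_below h) < \<infinity>"
    using emeasure_lines_below_finite[OF h] unfolding line_measure_def
    by (subst (asm) emeasure_restrict_space) (auto simp: line_domain_borel lines_below_def)
  have "integrable lborel (\<lambda>G. indicator (lines_below h) G *\<^sub>R g (snd G))"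
  proof (rule integrableI_bounded_set_indicator[OF _ _ emeasure])
    show "lines_below h \<in> sets lborel" using lines_below_borel[OF h] by simp
    have "(\<lambda>G. g (snd G)) \<in> borel_measurable (borel :: (real \<times> real) measure)"
      by (intro borel_measurable_continuous_onI continuous_on_compose2[OF g] continuous_intros) auto
    then show "(\<lambda>G. g (snd G)) \<in> borel_measurable (lborel :: (real \<times> real) measure)" by simp
    show "AE G in lborel. G \<in> lines_below h \<longrightarrow> norm (g (snd G)) \<le> B"
      using B by (intro AE_I2) (auto simp: lines_below_def)
  qed
  then have int: "integrable (lborel \<Otimes>\<^sub>M lborel) ?F"
    by (simp add: lborel_prod)
  have "(LINT G|line_measure. ?F G) = (LINT G|lborel. indicator ({0<..} \<times> {0..<2 * pi}) G *\<^sub>R ?F G)"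
    unfolding line_measure_def by (rule integral_restrict_space) (simp add: line_domain_borel)
  also have "\<dots> = (LINT G|lborel. ?F G)"
    by (rule Bochner_Integration.integral_cong) (auto simp: lines_below_def indicator_def)
  also have "\<dots> = (LINT G|(lborel \<Otimes>\<^sub>M lborel). (case G of (p, \<phi>) \<Rightarrow> ?F (p, \<phi>)))"
    by (simp add: lborel_prod case_prod_unfold)
  also have "\<dots> = (LINT \<phi>|lborel. LINT p|lborel. ?F (p, \<phi>))"
    using int by (intro lborel_pair.integral_snd[symmetric]) (simp add: case_prod_unfold)
  also have "\<dots> = (LINT \<phi>|lborel. indicator {0..<2 * pi} \<phi> *\<^sub>R (h \<phi> * g \<phi>))"
  proof (rule Bochner_Integration.integral_cong[OF refl])
    fix \<phi>
    have "(LINT p|lborel. ?F (p, \<phi>))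
        = (LINT p|lborel. indicator {0<..h \<phi>} p * (indicator {0..<2 * pi} \<phi> * g \<phi>))"
      by (rule Bochner_Integration.integral_cong) (auto simp: lines_below_def indicator_def)
    also have "\<dots> = indicator {0..<2 * pi} \<phi> *\<^sub>R (h \<phi> * g \<phi>)"
      using pos[of \<phi>] by simp
    finally show "(LINT p|lborel. ?F (p, \<phi>)) = indicator {0..<2 * pi} \<phi> *\<^sub>R (h \<phi> * g \<phi>)" .
  qed
  also have "\<dots> = (LINT \<phi>:{0..<2 * pi}|lborel. h \<phi> * g \<phi>)"
    by (simp add: set_lebesgue_integral_def)
  also have "\<dots> = integral {0..<2 * pi} (\<lambda>\<phi>. h \<phi> * g \<phi>)"
  proof (rule set_borel_integral_eq_integral)
    have "set_integrable lborel {0..2 * pi} (\<lambda>\<phi>. h \<phi> * g \<phi>)"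
      by (rule borel_integrable_atLeastAtMost') (rule hg)
    then show "set_integrable lborel {0..<2 * pi} (\<lambda>\<phi>. h \<phi> * g \<phi>)"
      by (rule set_integrable_subset) auto
  qed
  also have "\<dots> = integral {0..2 * pi} (\<lambda>\<phi>. h \<phi> * g \<phi>)"
  proof (rule integral_spike_set)
    have "negligible {2 * pi}" by simp
    then show "negligible {x \<in> {0..<2 * pi} - {0..2 * pi}. h x * g x \<noteq> 0}"
      and "negligible {x \<in> {0..2 * pi} - {0..<2 * pi}. h x * g x \<noteq> 0}"
      by (auto intro: negligible_subset)
  qed
  finally show ?thesis .
qed

text \<open>Fubini's theorem, with the integration over one line carried out twice.\<close>

lemma line_pairs_integral:
  fixes h f :: "real \<Rightarrow> real"
  assumes h: "continuous_on UNIV h" and pos: "\<And>\<phi>. 0 \<le> h \<phi>" and f: "continuous_on UNIV f"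
  defines "F \<equiv> \<lambda>((p1, \<phi>1), (p2, \<phi>2)). f (\<phi>2 - \<phi>1)"
  shows "set_integrable (line_measure \<Otimes>\<^sub>M line_measure) (lines_below h \<times> lines_below h) F"
    and "(LINT z : lines_below h \<times> lines_below h | line_measure \<Otimes>\<^sub>M line_measure. F z)
      = correlation_integral h f"
proof -
  let ?M = line_measure and ?S = "lines_below h"
  interpret M: sigma_finite_measure ?M by (rule sigma_finite_line_measure)
  interpret pair_sigma_finite ?M ?M ..
  have F: "F z = f (snd (snd z) - snd (fst z))" for z
    by (simp add: F_def case_prod_unfold)
  have [measurable]: "f \<in> borel_measurable borel"
    using f by (rule borel_measurable_continuous_onI)
  have [measurable]: "snd \<in> borel_measurable ?M"
    by (intro borel_measurable_line_measure borel_measurable_continuous_onI continuous_intros)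
  have "compact (f ` {- (2 * pi)..2 * pi})"
    using f by (intro compact_continuous_image) (auto intro: continuous_on_subset)
  then have "bounded (f ` {- (2 * pi)..2 * pi})" by (rule compact_imp_bounded)
  then obtain B where B: "\<forall>y \<in> f ` {- (2 * pi)..2 * pi}. norm y \<le> B"
    unfolding bounded_iff ..
  show int: "set_integrable (?M \<Otimes>\<^sub>M ?M) (?S \<times> ?S) F"
    unfolding set_integrable_def
  proof (rule integrableI_bounded_set_indicator)
    show "?S \<times> ?S \<in> sets (?M \<Otimes>\<^sub>M ?M)"
      by (intro pair_measureI lines_below_measurable h)
    show "F \<in> borel_measurable (?M \<Otimes>\<^sub>M ?M)"
      unfolding F by measurable
    show "emeasure (?M \<Otimes>\<^sub>M ?M) (?S \<times> ?S) < \<infinity>"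
      using emeasure_lines_below_finite[OF h] lines_below_measurable[OF h]
      by (simp add: M.emeasure_pair_measure_Times ennreal_mult_less_top)
    have "norm (F z) \<le> B" if "z \<in> ?S \<times> ?S" for z
      unfolding F by (rule bspec[OF B imageI]) (use that in \<open>auto simp: lines_below_def\<close>)
    then show "AE z in ?M \<Otimes>\<^sub>M ?M. z \<in> ?S \<times> ?S \<longrightarrow> norm (F z) \<le> B"
      by simp
  qed
  define k where "k x = integral {0..2 * pi} (\<lambda>y. h y * f (y - x))" for x
  have f_shift: "continuous_on UNIV (\<lambda>y. f (y - x))" for x
    by (intro continuous_on_compose2[OF f] continuous_intros) auto
  have "continuous_on UNIV (\<lambda>x. integral (cbox 0 (2 * pi)) (\<lambda>y. h y * f (y - x)))"
    by (rule integral_continuous_on_param, unfold case_prod_unfold)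
       (intro continuous_intros continuous_on_compose2[OF f] continuous_on_compose2[OF h]; auto)
  then have k: "continuous_on UNIV k" by (simp add: k_def[abs_def])
  have inner: "(LINT G2|?M. indicator (?S \<times> ?S) (G1, G2) *\<^sub>R F (G1, G2))
      = indicator ?S G1 * k (snd G1)" for G1
    using lines_below_integral[OF h pos f_shift[of "snd G1"]]
    by (simp add: F indicator_times k_def mult.assoc)
  have "(LINT z : ?S \<times> ?S | ?M \<Otimes>\<^sub>M ?M. F z)
      = (LINT G1|?M. LINT G2|?M. indicator (?S \<times> ?S) (G1, G2) *\<^sub>R F (G1, G2))"
    unfolding set_lebesgue_integral_def
    using int by (intro integral_fst'[symmetric]) (simp add: set_integrable_def)
  also have "\<dots> = integral {0..2 * pi} (\<lambda>x. h x * k x)"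
    unfolding inner by (rule lines_below_integral[OF h pos k])
  also have "\<dots> = correlation_integral h f"
    using h by (subst correlation_integral_iterated[OF _ f])
      (auto simp: k_def mult.commute intro: continuous_on_subset)
  finally show "(LINT z : ?S \<times> ?S | ?M \<Otimes>\<^sub>M ?M. F z) = correlation_integral h f" .
qed

theorem theorem1:
  fixes K :: "(real ^ 2) set" and L :: real and f :: "real \<Rightarrow> real"
    and a b A :: "nat \<Rightarrow> real"
  assumes "compact K" and "convex K" and "0 \<in> interior K"
    and "C2_boundary_of_length K L"
    and "continuous_on UNIV f" and "\<And>\<phi>. f (\<phi> + 2 * pi) = f \<phi>"
    and "A = fourier_cos_coeff f"
    and "a = fourier_cos_coeff (support_fun K)"
    and "b = fourier_sin_coeff (support_fun K)"
  shows "set_integrable (line_measure \<Otimes>\<^sub>M line_measure) (line_pairs_meeting K)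
           (\<lambda>((p1, \<phi>1), (p2, \<phi>2)). f (\<phi>2 - \<phi>1)) \<and>
         summable (\<lambda>n. ((a (Suc n))\<^sup>2 + (b (Suc n))\<^sup>2) * A (Suc n)) \<and>
         (LINT ((p1, \<phi>1), (p2, \<phi>2)) : line_pairs_meeting K | line_measure \<Otimes>\<^sub>M line_measure.
             f (\<phi>2 - \<phi>1))
           = A 0 * L\<^sup>2 + pi\<^sup>2 * (\<Sum>n. ((a (Suc n))\<^sup>2 + (b (Suc n))\<^sup>2) * A (Suc n))"
proof -
  have K0: "0 \<in> K" using assms(3) interior_subset by blast
  then have "K \<noteq> {}" by blast
  note h = continuous_support_fun[OF assms(1) this]
  have pos: "0 \<le> support_fun K \<phi>" for \<phi>
    using inner_unit_dir_le_support_fun[OF assms(1) K0, of \<phi>] by simp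
  note pairs = line_pairs_meeting_eq[OF assms(1,2) K0]
  show ?thesis
    using line_pairs_integral[OF h pos assms(5)]
      correlation_integral_fourier[OF h assms(5,6)] cauchy_length_formula[OF assms(1-4)]
    unfolding pairs assms(7-9) by simp
qed

end
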